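(* Let $X$ be a separable metric space and let $\phi:\mathbb R\times X\to X$ be a continuous flow. For $x\in X$ let $\mathcal F(x)=\{\phi(t,x):t\in\mathbb R\}$ be the orbit of $x$, and let $\mathcal F=\{\mathcal F(x)\}_{x\in X}$. Let $\mu$ be any Borel probability measure on $X$ that is invariant and ergodic for the time-one map $\phi_1:=\phi(1,\cdot):X\to X$. Then one of the following holds: (1) there is a set $A\subset X$ of full $\mu$-measure such that, for $\mu$-almost every $x$, $\mathcal F(x)\cap A$ is a discrete subset of $\mathcal F(x)$; moreover there is a natural number $k\ge 1$ such that, for $\mu$-almost every $x$, $\mathcal F(x)\cap A$ is the $\phi_1$-orbit of exactly $k$ points (i.e. the union of exactly $k$ distinct $\phi_1$-orbits); or (2) for $\mu$-almost every $x\in X$ there is a measure $\mu_{\mathcal F(x)}$ on $\mathcal F(x)$ such that $$\mu_{\mathcal F(x)}\big(\phi([0,t]\times\{x\})\big)=2^{-1}t$$ whenever $t\ge 0$ and $\tau\mapsto\phi(\tau,x)$ is injective on $[0,t]$, where $\mu_{\mathcal F(x)}$ is $\phi_1$-invariant and the normalized restrictions of the measures $\mu_{\mathcal F(x)}$ to the plaques of any foliated chart of the orbit foliation form a disintegration of $\mu$ in that chart. In particular, in this case $\mu$ is invariant for the flow, i.e. $(\phi_t)_*\mu=\mu$ for all $t\in\mathbb R$.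
   Context: Write $\phi_t=\phi(t,\cdot)$. A probability $\mu$ is ergodic for $\phi_1$ if it is $\phi_1$-invariant and every $\phi_1$-invariant measurable set has measure $0$ or $1$. The orbit $\mathcal F(x)$ carries the leaf topology, i.e. the one coming from the time parametrization $\tau\mapsto\phi(\tau,x)$; "discrete subset of $\mathcal F(x)$" refers to this topology. A foliated chart of the orbit foliation is an open set $U\subset X$ with a homeomorphism $T\times I\to U$, where $I\subset\mathbb R$ is an open interval and $T$ is a transversal, carrying each $\{z\}\times I$ onto an orbit segment; these orbit segments are the plaques of $U$. A disintegration of $\mu$ in $U$ (when $\mu(U)>0$) is a system of conditional measures of the normalized restriction $\mu|_U/\mu(U)$ with respect to the partition of $U$ into plaques: a measurable family $\{\mu_P\}$ of probability measures, with $\mu_P(P)=1$ for almost every plaque $P$, such that $\int_U g\,d\mu/\mu(U)=\int\big(\int_P g\,d\mu_P\big)\,d\widetilde\mu(P)$ for bounded continuous $g$, where $\widetilde\mu$ is the projection of $\mu|_U/\mu(U)$ to the space of plaques. The statement in (2) means that for almost every plaque $P\subset\mathcal F(x)$, $\mu_P$ is the restriction of $\mu_{\mathcal F(x)}$ to $P$ divided by $\mu_{\mathcal F(x)}(P)$. *)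

theory Defs
  imports "HOL-Probability.Probability"
begin

definition continuous_flow :: "(real \<Rightarrow> 'a::topological_space \<Rightarrow> 'a) \<Rightarrow> bool" where
  "continuous_flow \<phi> \<longleftrightarrow>
     continuous_on UNIV (\<lambda>(t, x). \<phi> t x) \<and>
     (\<forall>x. \<phi> 0 x = x) \<and>
     (\<forall>s t x. \<phi> (s + t) x = \<phi> s (\<phi> t x))"

definition orbit :: "(real \<Rightarrow> 'a \<Rightarrow> 'a) \<Rightarrow> 'a \<Rightarrow> 'a set" where
  "orbit \<phi> x = range (\<lambda>t. \<phi> t x)"

text \<open>For a flow, \<open>\<phi> (of_int n)\<close> is the \<open>n\<close>-th iterate of the homeomorphism \<open>\<phi> 1\<close>,
  for negative \<open>n\<close> as well; so this is the full orbit of \<open>x\<close> under \<open>\<phi> 1\<close>.\<close>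

definition time_one_orbit :: "(real \<Rightarrow> 'a \<Rightarrow> 'a) \<Rightarrow> 'a \<Rightarrow> 'a set" where
  "time_one_orbit \<phi> x = range (\<lambda>n::int. \<phi> (of_int n) x)"

definition invariant_measure :: "('a \<Rightarrow> 'a) \<Rightarrow> 'a measure \<Rightarrow> bool" where
  "invariant_measure f M \<longleftrightarrow> f \<in> M \<rightarrow>\<^sub>M M \<and> distr M M f = M"

definition ergodic :: "('a \<Rightarrow> 'a) \<Rightarrow> 'a measure \<Rightarrow> bool" where
  "ergodic f M \<longleftrightarrow>
     invariant_measure f M \<and>
     (\<forall>A\<in>sets M. f -` A \<inter> space M = A \<longrightarrow> emeasure M A = 0 \<or> emeasure M A = 1)"

text \<open>The leaf topology is the quotient topology that the time parametrization induces on the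
  orbit. It is in general strictly finer than the topology induced from the ambient space.\<close>

definition leaf_topology :: "(real \<Rightarrow> 'a \<Rightarrow> 'a) \<Rightarrow> 'a \<Rightarrow> 'a topology" where
  "leaf_topology \<phi> x = topology (\<lambda>S. S \<subseteq> orbit \<phi> x \<and> open {t. \<phi> t x \<in> S})"

lemma openin_leaf_topology:
  "openin (leaf_topology \<phi> x) S \<longleftrightarrow> S \<subseteq> orbit \<phi> x \<and> open {t. \<phi> t x \<in> S}"
proof -
  have "istopology (\<lambda>S. S \<subseteq> orbit \<phi> x \<and> open {t. \<phi> t x \<in> S})"
    unfolding istopology_def
  proof (intro conjI allI impI)
    fix S T
    assume "S \<subseteq> orbit \<phi> x \<and> open {t. \<phi> t x \<in> S}" "T \<subseteq> orbit \<phi> x \<and> open {t. \<phi> t x \<in> T}"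
    then show "S \<inter> T \<subseteq> orbit \<phi> x" "open {t. \<phi> t x \<in> S \<inter> T}"
      by (auto simp: Collect_conj_eq)
  next
    fix \<K> assume *: "\<forall>K\<in>\<K>. K \<subseteq> orbit \<phi> x \<and> open {t. \<phi> t x \<in> K}"
    then show "\<Union>\<K> \<subseteq> orbit \<phi> x" by blast
    have "{t. \<phi> t x \<in> \<Union>\<K>} = (\<Union>K\<in>\<K>. {t. \<phi> t x \<in> K})" by blast
    with * show "open {t. \<phi> t x \<in> \<Union>\<K>}" by auto
  qed
  then show ?thesis
    by (simp add: leaf_topology_def)
qed

lemma topspace_leaf_topology: "topspace (leaf_topology \<phi> x) = orbit \<phi> x"
proof -
  have "openin (leaf_topology \<phi> x) (orbit \<phi> x)"
    by (simp add: openin_leaf_topology orbit_def)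
  then show ?thesis
    by (metis openin_leaf_topology openin_subset openin_topspace subset_antisym)
qed

definition discrete_in_leaf :: "(real \<Rightarrow> 'a \<Rightarrow> 'a) \<Rightarrow> 'a \<Rightarrow> 'a set \<Rightarrow> bool" where
  "discrete_in_leaf \<phi> x D \<longleftrightarrow>
     D \<subseteq> orbit \<phi> x \<and> subtopology (leaf_topology \<phi> x) D = discrete_topology D"

text \<open>\<open>M|A / M(A)\<close>, as a measure on \<open>A\<close>; it is the zero measure if \<open>M(A)\<close> is \<open>0\<close> or \<open>\<infinity>\<close>.\<close>

definition normalized_restriction :: "'a measure \<Rightarrow> 'a set \<Rightarrow> 'a measure" where
  "normalized_restriction M A = scale_measure (1 / emeasure M A) (restrict_space M A)"

definition plaque :: "('a \<times> real \<Rightarrow> 'a) \<Rightarrow> real set \<Rightarrow> 'a \<Rightarrow> 'a set" where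
  "plaque h I z = h ` ({z} \<times> I)"

text \<open>\<open>h\<close> is the chart \<open>T \<times> I \<rightarrow> U\<close> and \<open>g\<close> its inverse. The transversal is modelled by a subset
  \<open>T\<close> of the phase space with the subspace topology. This loses no charts: whatever space indexes
  the plaques, it is homeomorphic to the slice of \<open>U\<close> at any fixed parameter in \<open>I\<close>.\<close>

definition foliated_chart ::
  "(real \<Rightarrow> 'a::topological_space \<Rightarrow> 'a) \<Rightarrow> 'a set \<Rightarrow> 'a set \<Rightarrow> real set \<Rightarrow>
   ('a \<times> real \<Rightarrow> 'a) \<Rightarrow> ('a \<Rightarrow> 'a \<times> real) \<Rightarrow> bool" where
  "foliated_chart \<phi> U T I h g \<longleftrightarrow>
     open U \<and> open I \<and> is_interval I \<and> I \<noteq> {} \<and>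
     homeomorphism (T \<times> I) U h g \<and>
     (\<forall>z\<in>T. \<exists>x J. is_interval J \<and> plaque h I z = (\<lambda>t. \<phi> t x) ` J)"

text \<open>The space of plaques is identified with \<open>T\<close> through \<open>z \<mapsto> plaque h I z\<close>.\<close>

definition plaque_space_measure ::
  "'a::topological_space measure \<Rightarrow> 'a set \<Rightarrow> 'a set \<Rightarrow> ('a \<Rightarrow> 'a \<times> real) \<Rightarrow> 'a measure" where
  "plaque_space_measure M U T g =
     distr (normalized_restriction M U) (restrict_space borel T) (\<lambda>y. fst (g y))"

text \<open>\<open>\<kappa> z\<close> is the conditional measure of the plaque of \<open>z\<close>, as a Borel probability on the phase
  space that gives full mass to that plaque (for almost every plaque).\<close>

definition disintegration_in_chart ::
  "'a::topological_space measure \<Rightarrow> 'a set \<Rightarrow> 'a set \<Rightarrow> real set \<Rightarrow>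
   ('a \<times> real \<Rightarrow> 'a) \<Rightarrow> ('a \<Rightarrow> 'a \<times> real) \<Rightarrow> ('a \<Rightarrow> 'a measure) \<Rightarrow> bool" where
  "disintegration_in_chart M U T I h g \<kappa> \<longleftrightarrow>
     \<kappa> \<in> restrict_space borel T \<rightarrow>\<^sub>M prob_algebra borel \<and>
     (AE z in plaque_space_measure M U T g. emeasure (\<kappa> z) (plaque h I z) = 1) \<and>
     (\<forall>b::'a \<Rightarrow> real. continuous_on U b \<and> bounded (b ` U) \<longrightarrow>
        (LINT y:U|M. b y) / measure M U =
        (LINT z|plaque_space_measure M U T g. (LINT y:plaque h I z|\<kappa> z. b y)))"

text \<open>The leafwise measures \<open>m\<close> are indexed by the leaves themselves.\<close>

definition disintegrates_along_orbits ::
  "(real \<Rightarrow> 'a::topological_space \<Rightarrow> 'a) \<Rightarrow> 'a measure \<Rightarrow> ('a set \<Rightarrow> 'a measure) \<Rightarrow> bool" where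
  "disintegrates_along_orbits \<phi> M m \<longleftrightarrow>
     (\<forall>U T I h g. foliated_chart \<phi> U T I h g \<and> emeasure M U > 0 \<longrightarrow>
        (\<exists>\<kappa>. disintegration_in_chart M U T I h g \<kappa> \<and>
             (AE z in plaque_space_measure M U T g. \<forall>x\<in>plaque h I z.
                restrict_space (\<kappa> z) (plaque h I z) =
                normalized_restriction (m (orbit \<phi> x)) (plaque h I z))))"

end

theory Submission
  imports Defs
begin

text \<open>The times \<open>t\<close> with \<open>(\<phi> t)\<^sub>* \<mu> = \<mu>\<close> form a closed subgroup \<open>G\<close> of \<open>\<real>\<close> containing \<open>1\<close>. Call \<open>x\<close> generic if
  the frequency of visits of its \<open>\<phi> 1\<close>-orbit to each open set \<open>W\<close> is asymptotically at least \<open>\<mu> W\<close>; by the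
  maximal ergodic inequality almost every point is generic. A point is generic for at most one
  measure, so the generic points on the orbit of a generic point \<open>x\<close> are exactly the \<open>\<phi> t x\<close> with
  \<open>t \<in> G\<close>. If \<open>G = p\<int>\<close>, the generic set thus meets almost every orbit in a discrete set, and the number
  of \<open>\<phi> 1\<close>-orbits in it is almost surely constant by ergodicity.

  If \<open>G = \<real>\<close>, then either \<open>\<mu>\<close> is a Dirac measure at a fixed point or almost no point is fixed. In the
  latter case the leaf measures are half of the length of time. That they disintegrate \<open>\<mu>\<close> in a chart
  \<open>U\<close> is a mass transport: let every \<open>y \<in> U\<close> spread its mass uniformly in time over its plaque;
  by invariance of \<open>\<mu>\<close> and Fubini, every point receives as much as it sends out.\<close>

subsection \<open>Subgroups of the line, Borel measures and the maximal ergodic inequality\<close>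

text \<open>\<open>X\<close> is not assumed complete, so the usual existence theorem for conditional
  measures does not apply. The conditional measures are therefore written down as uniform
  distributions in time, and the identity that characterizes them is proved. Two features of orbits
  make this delicate. A plaque may last for an infinite time and then carries no uniform
  distribution; such plaques are shown to be negligible by a mass transport of their own. And an
  orbit may be periodic, so that time does not parametrize it injectively: leaf measures are images
  of Lebesgue measure on a section of the orbit map, and periods can merge some of the
  \<open>\<phi> 1\<close>-orbits that are counted in the discrete case. Genericity is one-sided
  because lower bounds on open sets already force uniqueness: an open set and the complement of a
  closed superset are disjoint, so their frequencies add up to at most 1.\<close>

lemma closed_additive_subgroup_real:
  fixes G :: "real set"
  assumes cl: "closed G" and zero: "0 \<in> G" and diff: "\<And>x y. x \<in> G \<Longrightarrow> y \<in> G \<Longrightarrow> x - y \<in> G"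
  shows "G = UNIV \<or> (\<exists>p\<ge>0. G = range (\<lambda>n::int. of_int n * p))"
proof -
  have neg: "- x \<in> G" if "x \<in> G" for x
    using diff[OF zero that] by simp
  have add: "x + y \<in> G" if "x \<in> G" "y \<in> G" for x y
    using diff[OF that(1) neg[OF that(2)]] by simp
  have natmult: "of_nat n * x \<in> G" if "x \<in> G" for x and n :: nat
    by (induction n) (auto simp: zero distrib_right intro: add that)
  have intmult: "of_int n * x \<in> G" if "x \<in> G" for x and n :: int
    using natmult[OF that, of "nat n"] neg[OF natmult[OF that, of "nat (- n)"]] by (cases "n \<ge> 0") auto
  \<comment> \<open>If the positive elements keep a distance \<open>e\<close> from 0, they form a
    closed set, whose least element generates \<open>G\<close>. Otherwise the multiples of small
    positive elements are dense.\<close>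
  define P where "P = {x \<in> G. x > 0}"
  show ?thesis
  proof (cases "\<exists>e>0. \<forall>x\<in>P. e \<le> x")
    case True
    then obtain e where e: "e > 0" "\<And>x. x \<in> P \<Longrightarrow> e \<le> x" by blast
    show ?thesis
    proof (cases "P = {}")
      case True
      then have "G = {0}"
        using zero neg unfolding P_def by (auto, metis neg_0_less_iff_less not_less_iff_gr_or_eq)
      then show ?thesis by (intro disjI2 exI[of _ 0]) auto
    next
      case False
      have "closed (G \<inter> {e..})" using cl by blast
      moreover have PG: "P = G \<inter> {e..}" using e unfolding P_def by fastforce
      ultimately have clP: "closed P" by simp
      define p where "p = Inf P"
      have bdd: "bdd_below P" using e(2) by (meson bdd_belowI)
      have pP: "p \<in> P" unfolding p_def using closed_contains_Inf[OF False bdd clP] .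
      then have p: "p > 0" "p \<in> G" by (auto simp: P_def)
      have "x \<in> range (\<lambda>n::int. of_int n * p)" if "x \<in> G" for x
      proof -
        define r where "r = x - of_int \<lfloor>x / p\<rfloor> * p"
        have rG: "r \<in> G" unfolding r_def by (intro diff intmult that p)
        have "r < p" "r \<ge> 0"
          unfolding r_def using floor_divide_lower[of p x] floor_divide_upper[of p x] p
          by (auto simp: algebra_simps)
        moreover have "p \<le> r" if "r > 0"
          using cInf_lower[OF _ bdd, of r] that rG by (auto simp: p_def P_def)
        ultimately have "r = 0" by force
        then show ?thesis unfolding r_def by (auto intro!: image_eqI[of _ _ "\<lfloor>x / p\<rfloor>"])
      qed
      then show ?thesis using intmult p by (intro disjI2 exI[of _ p]) auto
    qed
  next
    case False
    have "x \<in> closure G" for x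
      unfolding closure_approachable
    proof (intro allI impI)
      fix e :: real assume "e > 0"
      then obtain q where q: "q \<in> P" "q < e" using False by force
      have "of_int \<lfloor>x / q\<rfloor> * q \<in> G" using q by (auto simp: P_def intro: intmult)
      moreover have "dist (of_int \<lfloor>x / q\<rfloor> * q) x < e"
        using floor_divide_lower[of q x] floor_divide_upper[of q x] q
        by (auto simp: P_def dist_real_def algebra_simps)
      ultimately show "\<exists>y\<in>G. dist y x < e" by blast
    qed
    then show ?thesis using cl by auto
  qed
qed

lemma measure_infdist_shrink:
  fixes N :: "'a::metric_space measure"
  assumes "finite_measure N" "sets N = sets borel" "closed K" "K \<noteq> {}"
  shows "(\<lambda>n. measure N {x. infdist x K \<le> 1 / Suc n}) \<longlonglongrightarrow> measure N K"
    and "(\<lambda>n. measure N {x. infdist x K < 1 / Suc n}) \<longlonglongrightarrow> measure N K"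
proof -
  interpret finite_measure N by fact
  have lim: "infdist x K \<le> 0" if "\<And>n. infdist x K \<le> 1 / Suc n" for x
    by (rule LIMSEQ_le_const[OF LIMSEQ_inverse_real_of_nat])
      (use that in \<open>auto simp: inverse_eq_divide\<close>)
  have K: "infdist x K \<le> 0 \<longleftrightarrow> x \<in> K" for x
    using in_closed_iff_infdist_zero[OF assms(3,4), of x] infdist_nonneg[of x K] by linarith
  have mono: "1 / real (Suc n) \<le> 1 / real (Suc m)" if "m \<le> n" for m n
    using that by (simp add: frac_le)
  have K0: "infdist x K = 0" if "x \<in> K" for x using that by simp
  have i1: "(\<Inter>n. {x. infdist x K \<le> 1 / Suc n}) = K"
  proof (intro set_eqI iffI)
    fix x assume "x \<in> (\<Inter>n. {x. infdist x K \<le> 1 / Suc n})"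
    then have "infdist x K \<le> 1 / Suc n" for n by blast
    from lim[OF this] K show "x \<in> K" by blast
  qed (simp add: K0)
  have i2: "(\<Inter>n. {x. infdist x K < 1 / Suc n}) = K"
  proof (intro set_eqI iffI)
    fix x assume "x \<in> (\<Inter>n. {x. infdist x K < 1 / Suc n})"
    then have "infdist x K < 1 / Suc n" for n by blast
    from lim[OF less_imp_le[OF this]] K show "x \<in> K" by blast
  qed (simp add: K0)
  have d1: "decseq (\<lambda>n. {x. infdist x K \<le> 1 / Suc n})"
    unfolding decseq_def using order_trans[OF _ mono] by blast
  have d2: "decseq (\<lambda>n. {x. infdist x K < 1 / Suc n})"
    unfolding decseq_def using less_le_trans[OF _ mono] by blast
  have "(\<lambda>n. measure N {x. infdist x K \<le> 1 / Suc n}) \<longlonglongrightarrow> measure N (\<Inter>n. {x. infdist x K \<le> 1 / Suc n})"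
    by (rule finite_Lim_measure_decseq)
      (use d1 in \<open>auto simp: assms(2)
        intro!: borel_closed closed_Collect_le continuous_intros\<close>)
  then show "(\<lambda>n. measure N {x. infdist x K \<le> 1 / Suc n}) \<longlonglongrightarrow> measure N K" by (simp only: i1)
  have "(\<lambda>n. measure N {x. infdist x K < 1 / Suc n}) \<longlonglongrightarrow> measure N (\<Inter>n. {x. infdist x K < 1 / Suc n})"
    by (rule finite_Lim_measure_decseq)
      (use d2 in \<open>auto simp: assms(2)
        intro!: borel_open open_Collect_less continuous_intros\<close>)
  then show "(\<lambda>n. measure N {x. infdist x K < 1 / Suc n}) \<longlonglongrightarrow> measure N K" by (simp only: i2)
qed

text \<open>Limit arguments compare an open set only with a closed superset. Placing an open
  neighbourhood of \<open>K\<close> inside a closed one and shrinking both gives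
  \<open>M K \<le> N K\<close> for closed \<open>K\<close>; complements give the reverse inequality
  on open sets, and shrinking open neighbourhoods carries it back to closed sets.\<close>

lemma prob_eqI_open_closed:
  fixes M N :: "'a::metric_space measure"
  assumes M: "prob_space M" "sets M = sets borel" and N: "prob_space N" "sets N = sets borel"
    and le: "\<And>W K. open W \<Longrightarrow> closed K \<Longrightarrow> W \<subseteq> K \<Longrightarrow> measure M W \<le> measure N K"
  shows "M = N"
proof -
  interpret M: prob_space M by fact
  interpret N: prob_space N by fact
  have sp: "space M = UNIV" "space N = UNIV"
    using sets_eq_imp_space_eq[OF M(2)] sets_eq_imp_space_eq[OF N(2)] by simp_all
  have closed_le: "measure M K \<le> measure N K" if K: "closed K" for K
  proof (cases "K = {}")
    case False
    have "measure M K \<le> measure N {x. infdist x K \<le> 1 / Suc n}" for n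
    proof -
      have "measure M K \<le> measure M {x. infdist x K < 1 / Suc n}"
        by (rule M.finite_measure_mono)
          (auto simp: M(2) in_closed_iff_infdist_zero[OF K False]
            intro!: borel_open open_Collect_less continuous_intros)
      also have "\<dots> \<le> measure N {x. infdist x K \<le> 1 / Suc n}"
        by (rule le) (auto intro!: open_Collect_less closed_Collect_le continuous_intros)
      finally show ?thesis .
    qed
    then show ?thesis
      by (intro LIMSEQ_le_const[OF measure_infdist_shrink(1)[OF N.finite_measure_axioms N(2) K False]]) auto
  qed auto
  have open_le: "measure N W \<le> measure M W" if "open W" for W
  proof -
    have "W \<in> sets M" "W \<in> sets N" "closed (- W)" using that M(2) N(2) by auto
    then show ?thesis
      using closed_le[of "- W"] M.prob_compl[of W] N.prob_compl[of W] sp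
      by (simp add: Compl_eq_Diff_UNIV)
  qed
  have eq: "measure M K = measure N K" if K: "closed K" for K
  proof (cases "K = {}")
    case False
    have "measure N K \<le> measure M {x. infdist x K < 1 / Suc n}" for n
    proof -
      have "measure N K \<le> measure N {x. infdist x K < 1 / Suc n}"
        by (rule N.finite_measure_mono)
          (auto simp: N(2) in_closed_iff_infdist_zero[OF K False]
            intro!: borel_open open_Collect_less continuous_intros)
      also have "\<dots> \<le> measure M {x. infdist x K < 1 / Suc n}"
        by (rule open_le) (auto intro!: open_Collect_less continuous_intros)
      finally show ?thesis .
    qed
    then have "measure N K \<le> measure M K"
      by (intro LIMSEQ_le_const[OF measure_infdist_shrink(2)[OF M.finite_measure_axioms M(2) K False]]) auto
    with closed_le[OF K] show ?thesis by simp
  qed auto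
  show ?thesis
  proof (rule measure_eqI_generator_eq[where E = "{K. closed K}" and \<Omega> = UNIV and A = "\<lambda>_. UNIV"])
    show "Int_stable {K::'a set. closed K}" by (auto simp: Int_stable_def)
    show "emeasure M X = emeasure N X" if "X \<in> {K. closed K}" for X
      using eq that by (simp add: M.emeasure_eq_measure N.emeasure_eq_measure)
    show "sets M = sigma_sets UNIV {K. closed K}" "sets N = sigma_sets UNIV {K. closed K}"
      unfolding M(2) N(2) by (simp_all add: borel_eq_closed)
    show "range (\<lambda>_. UNIV) \<subseteq> {K::'a set. closed K}" by blast
    show "emeasure M UNIV \<noteq> \<infinity>" by simp
  qed simp_all
qed

text \<open>Garsia's argument: \<open>F N\<close> is the maximum of the ergodic sums of length at most \<open>N\<close>, cut off at
  \<open>0\<close>, and \<open>h \<ge> F N - F N \<circ> T\<close> wherever \<open>F N > 0\<close>.\<close>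

lemma maximal_ergodic:
  fixes h :: "'a \<Rightarrow> real"
  assumes M: "prob_space M" and inv: "invariant_measure T M"
    and h: "h \<in> borel_measurable M" "\<And>x. \<bar>h x\<bar> \<le> C"
    and pos: "AE x in M. \<exists>n. (\<Sum>j<n. h ((T ^^ j) x)) > 0"
  shows "(\<integral>x. h x \<partial>M) \<ge> 0"
proof -
  interpret prob_space M by fact
  have T[measurable]: "T \<in> M \<rightarrow>\<^sub>M M" and dT: "distr M M T = M"
    using inv by (auto simp: invariant_measure_def)
  note h(1)[measurable]
  \<comment> \<open>Written as a recursion, the maximum satisfies
    \<open>F (Suc N) x = h x + F N (T x)\<close> wherever it is positive; \<open>sum_le\<close>
    links it to the ergodic sums.\<close>
  define F where "F N = rec_nat (\<lambda>x. 0) (\<lambda>_ f x. max 0 (h x + f (T x))) N" for N :: nat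
  have F0: "F 0 x = 0" and FS: "F (Suc N) x = max 0 (h x + F N (T x))" for N x
    by (auto simp: F_def)
  have F_nonneg: "F N x \<ge> 0" for N x by (cases N) (auto simp: F0 FS)
  have F_mono: "F N x \<le> F (Suc N) x" for N x
  proof (induction N arbitrary: x)
    case (Suc N)
    show ?case using Suc[of "T x"] by (simp add: FS[of N] FS[of "Suc N"])
  qed (simp add: F0 F_nonneg)
  have F_mono': "mono (\<lambda>N. F N x)" for x using F_mono by (auto simp: mono_iff_le_Suc)
  have meas[measurable]: "F N \<in> borel_measurable M" for N
  proof (induction N)
    case (Suc N)
    note Suc[measurable]
    show ?case unfolding FS[abs_def] by measurable
  qed (simp add: F0[abs_def])
  have C: "C \<ge> 0" using h(2)[of undefined] by linarith
  have F_bound: "F N x \<le> of_nat N * C" for N x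
  proof (induction N arbitrary: x)
    case (Suc N)
    show ?case using Suc[of "T x"] h(2)[of x] C by (simp add: FS algebra_simps)
  qed (simp add: F0)
  have intF: "integrable M (F N)" for N
    by (rule integrable_const_bound[of _ "of_nat N * C"]) (use F_nonneg F_bound in auto)
  have intFT: "integrable M (\<lambda>x. F N (T x))" for N
    by (rule integrable_const_bound[of _ "of_nat N * C"]) (use F_nonneg F_bound in auto)
  have FT_eq: "(\<integral>x. F N (T x) \<partial>M) = (\<integral>x. F N x \<partial>M)" for N
    using integral_distr[OF T, of "F N"] by (simp add: dT)
  have sum_le: "n \<le> N \<Longrightarrow> (\<Sum>j<n. h ((T ^^ j) x)) \<le> F N x" for n N x
  proof (induction n arbitrary: x N)
    case (Suc n)
    then obtain N' where N': "N = Suc N'" "n \<le> N'" by (metis Suc_le_D Suc_le_mono)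
    have "(\<Sum>j<Suc n. h ((T ^^ j) x)) = h x + (\<Sum>j<n. h ((T ^^ j) (T x)))"
      unfolding sum.lessThan_Suc_shift by (simp add: funpow_swap1)
    also have "\<dots> \<le> h x + F N' (T x)" using Suc.IH[OF N'(2), of "T x"] by simp
    also have "\<dots> \<le> F N x" by (simp add: N' FS)
    finally show ?case .
  qed (simp add: F_nonneg)
  define E where "E N = {x \<in> space M. F N x > 0}" for N
  have [measurable]: "E N \<in> sets M" for N unfolding E_def by measurable
  \<comment> \<open>Where \<open>F N\<close> is positive, \<open>h x = F N x - F N' (T x)\<close>
    for the predecessor \<open>N'\<close>, and \<open>F N'\<close> is at most \<open>F N\<close>.
    Elsewhere \<open>F N x = 0\<close>, and the left side is at most 0.\<close>
  have key: "F N x - F N (T x) \<le> h x * indicator (E N) x" if "x \<in> space M" for N x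
  proof (cases "F N x > 0")
    case True
    then obtain N' where N': "N = Suc N'" by (cases N) (auto simp: F0)
    have "F N x = h x + F N' (T x)" using True by (auto simp: N' FS max_def split: if_splits)
    also have "\<dots> \<le> h x + F N (T x)" using F_mono[of N' "T x"] by (simp add: N')
    finally show ?thesis using True that by (simp add: E_def)
  next
    case False
    then show ?thesis using F_nonneg[of N x] F_nonneg[of N "T x"] by (simp add: E_def)
  qed
  have int1: "integrable M (\<lambda>x. h x * indicator (E N) x)" for N
    by (rule integrable_const_bound[of _ C]) (use h(2) C in \<open>auto split: split_indicator\<close>)
  have nonneg: "(\<integral>x. h x * indicator (E N) x \<partial>M) \<ge> 0" for N
  proof -
    have "0 = (\<integral>x. F N x - F N (T x) \<partial>M)" by (simp add: intF intFT FT_eq)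
    also have "\<dots> \<le> (\<integral>x. h x * indicator (E N) x \<partial>M)"
      by (intro integral_mono int1 key Bochner_Integration.integrable_diff intF intFT) auto
    finally show ?thesis .
  qed
  \<comment> \<open>By \<open>pos\<close> almost every point eventually lies in \<open>E N\<close>,
    so the indicator disappears in the limit.\<close>
  have "(\<lambda>N. \<integral>x. h x * indicator (E N) x \<partial>M) \<longlonglongrightarrow> (\<integral>x. h x \<partial>M)"
  proof (rule integral_dominated_convergence[where w = "\<lambda>_. C"])
    show "AE x in M. (\<lambda>N. h x * indicator (E N) x) \<longlonglongrightarrow> h x"
      using pos AE_space
    proof eventually_elim
      case (elim x)
      then obtain n where n: "(\<Sum>j<n. h ((T ^^ j) x)) > 0" by blast
      have "x \<in> E N" if "N \<ge> n" for N
        using sum_le[OF that, of x] n elim by (auto simp: E_def)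
      then have "\<forall>N\<ge>n. h x * indicator (E N) x = h x" by simp
      then have "eventually (\<lambda>N. h x * indicator (E N) x = h x) sequentially"
        unfolding eventually_sequentially by blast
      then show ?case by (rule tendsto_eventually)
    qed
    show "AE x in M. norm (h x * indicator (E N) x) \<le> C" for N
      using h(2) C by (auto split: split_indicator)
  qed auto
  then show ?thesis by (rule LIMSEQ_le_const) (use nonneg in auto)
qed

text \<open>The finite unions of basic open sets. They reduce the condition on all open sets in the
  definition of \<open>generic\<close> to countably many conditions, which makes the set of generic
  points Borel and of full measure.\<close>

lemma finite_measure_countable_inner_open:
  fixes M :: "'a::second_countable_topology measure"
  assumes "finite_measure M" and M: "sets M = sets borel"
  obtains \<F> :: "'a set set" where "countable \<F>" "\<And>U. U \<in> \<F> \<Longrightarrow> open U"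
    "\<And>W a. open W \<Longrightarrow> a < measure M W \<Longrightarrow> \<exists>U\<in>\<F>. U \<subseteq> W \<and> a < measure M U"
proof -
  interpret finite_measure M by fact
  obtain B :: "'a set set" where B: "countable B" "topological_basis B"
    using ex_countable_basis by blast
  define \<F> where "\<F> = Union ` {F. finite F \<and> F \<subseteq> B}"
  have opn: "open U" if "U \<in> \<F>" for U
    using that B(2) by (auto simp: \<F>_def intro!: open_Union dest: topological_basis_open)
  show ?thesis
  proof
    show "countable \<F>"
      unfolding \<F>_def using countable_Collect_finite_subset[OF B(1)] by blast
    fix W :: "'a set" and a assume W: "open W" "a < measure M W"
    show "\<exists>U\<in>\<F>. U \<subseteq> W \<and> a < measure M U"
    proof (cases "W = {}")
      case True
      then show ?thesis using W(2) by (auto simp: \<F>_def intro!: exI[of _ "{}"])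
    next
      case False
      obtain B' where B': "B' \<subseteq> B" "\<Union>B' = W" using B(2) W(1) by (auto simp: topological_basis_def)
      have ne: "B' \<noteq> {}" using False B'(2) by auto
      have cnt: "countable B'" using B(1) B'(1) countable_subset by blast
      define V where "V n = (\<Union>i\<le>n. from_nat_into B' i)" for n :: nat
      have VF: "V n \<in> \<F>" for n
        unfolding \<F>_def V_def using from_nat_into[OF ne] B'(1)
        by (intro image_eqI[of _ _ "from_nat_into B' ` {..n}"]) auto
      have "(\<Union>n. V n) = W"
      proof -
        have "(\<Union>n. V n) = (\<Union>i. from_nat_into B' i)"
          unfolding V_def by (auto simp: atMost_def)
        then show ?thesis using range_from_nat_into[OF ne cnt] B'(2) by simp
      qed
      moreover have "(\<lambda>n. measure M (V n)) \<longlonglongrightarrow> measure M (\<Union>n. V n)"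
      proof (rule finite_Lim_measure_incseq)
        show "range V \<subseteq> sets M" using VF opn M by auto
        show "incseq V" by (force simp: incseq_def V_def)
      qed
      ultimately have "eventually (\<lambda>n. a < measure M (V n)) sequentially"
        using W(2) by (auto intro: order_tendstoD)
      then obtain n where "a < measure M (V n)" by (auto simp: eventually_sequentially)
      then show ?thesis using VF \<open>(\<Union>n. V n) = W\<close> by blast
    qed
  qed (use opn in auto)
qed

subsection \<open>Generic points of a flow\<close>

locale cont_flow =
  fixes \<phi> :: "real \<Rightarrow> 'a::{metric_space, second_countable_topology} \<Rightarrow> 'a"
  assumes flow: "continuous_flow \<phi>"
begin

lemma flow_zero [simp]: "\<phi> 0 x = x"
  and flow_flow: "\<phi> s (\<phi> t x) = \<phi> (s + t) x"
  using flow by (auto simp: continuous_flow_def)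

lemma continuous_on_flow [continuous_intros]:
  assumes "continuous_on S f" "continuous_on S g"
  shows "continuous_on S (\<lambda>u. \<phi> (f u) (g u))"
proof -
  have "continuous_on UNIV (\<lambda>(t, x). \<phi> t x)" using flow by (simp add: continuous_flow_def)
  from continuous_on_compose2[OF this continuous_on_Pair[OF assms]] show ?thesis by simp
qed

lemma measurable_flow [measurable (raw)]:
  assumes [measurable]: "f \<in> M \<rightarrow>\<^sub>M borel" "g \<in> M \<rightarrow>\<^sub>M borel"
  shows "(\<lambda>u. \<phi> (f u) (g u)) \<in> M \<rightarrow>\<^sub>M borel"
proof -
  have "(\<lambda>p. \<phi> (fst p) (snd p)) \<in> borel \<rightarrow>\<^sub>M borel"
    by (intro borel_measurable_continuous_onI continuous_intros)
  then have [measurable]: "(\<lambda>p. \<phi> (fst p) (snd p)) \<in> borel \<Otimes>\<^sub>M borel \<rightarrow>\<^sub>M borel"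
    by (simp add: borel_prod)
  have "(\<lambda>u. (\<lambda>p. \<phi> (fst p) (snd p)) (f u, g u)) \<in> M \<rightarrow>\<^sub>M borel"
    by measurable
  then show ?thesis by simp
qed

lemma open_vimage_flow: "open W \<Longrightarrow> open (\<phi> t -` W)"
  by (rule open_vimage) (auto intro: continuous_intros)

lemma funpow_flow: "(\<phi> 1 ^^ j) x = \<phi> (real j) x"
  by (induction j) (auto simp: flow_flow)

lemma orbit_flow [simp]: "orbit \<phi> (\<phi> t x) = orbit \<phi> x"
proof -
  have "\<phi> s x \<in> range (\<lambda>s. \<phi> (s + t) x)" for s
    by (intro image_eqI[of _ _ "s - t"]) auto
  then show ?thesis unfolding orbit_def by (auto simp: flow_flow)
qed

lemma in_orbit [simp]: "\<phi> t x \<in> orbit \<phi> x" "x \<in> orbit \<phi> x"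
  unfolding orbit_def by (auto intro: image_eqI[of _ _ 0])

lemma orbit_eq: "y \<in> orbit \<phi> x \<Longrightarrow> orbit \<phi> y = orbit \<phi> x"
  by (metis orbit_def orbit_flow rangeE)

lemma time_one_orbit_eq_iff:
  "time_one_orbit \<phi> y = time_one_orbit \<phi> x \<longleftrightarrow> (\<exists>n::int. y = \<phi> (of_int n) x)"
proof
  assume "time_one_orbit \<phi> y = time_one_orbit \<phi> x"
  moreover have "y \<in> time_one_orbit \<phi> y"
    unfolding time_one_orbit_def by (auto intro: image_eqI[of _ _ 0])
  ultimately show "\<exists>n::int. y = \<phi> (of_int n) x" by (auto simp: time_one_orbit_def)
next
  assume "\<exists>n::int. y = \<phi> (of_int n) x"
  then obtain n :: int where n: "y = \<phi> (of_int n) x" ..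
  have "\<phi> (of_int m) x \<in> time_one_orbit \<phi> y" for m
    unfolding time_one_orbit_def n flow_flow by (auto intro!: image_eqI[of _ _ "m - n"])
  moreover have "\<phi> (of_int m) y \<in> time_one_orbit \<phi> x" for m
    unfolding time_one_orbit_def n flow_flow by (auto intro!: image_eqI[of _ _ "m + n"])
  ultimately show "time_one_orbit \<phi> y = time_one_orbit \<phi> x"
    by (auto simp: time_one_orbit_def[of \<phi> y, THEN equalityD1, THEN subsetD]
        time_one_orbit_def[of \<phi> x, THEN equalityD1, THEN subsetD])
      (auto simp: time_one_orbit_def)
qed

definition freq :: "nat \<Rightarrow> 'a set \<Rightarrow> 'a \<Rightarrow> real" where
  "freq n W x = (\<Sum>j<n. indicator W (\<phi> (real j) x)) / real n"

lemma freq_flow: "freq n W (\<phi> t x) = freq n (\<phi> t -` W) x"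
  unfolding freq_def by (simp add: indicator_def flow_flow add.commute)

lemma freq_mono: "U \<subseteq> W \<Longrightarrow> freq n U x \<le> freq n W x"
  unfolding freq_def by (intro divide_right_mono sum_mono) (auto split: split_indicator)

lemma freq_disjoint:
  assumes "U \<inter> W = {}"
  shows "freq n U x + freq n W x \<le> 1"
proof -
  have "(\<Sum>j<n. indicator U (\<phi> (real j) x)) + (\<Sum>j<n. indicator W (\<phi> (real j) x)) \<le> (\<Sum>j<n. 1::real)"
    unfolding sum.distrib[symmetric] by (intro sum_mono) (use assms in \<open>auto split: split_indicator\<close>)
  then show ?thesis
    unfolding freq_def by (cases "n = 0") (auto simp: add_divide_distrib[symmetric] divide_le_eq)
qed

text \<open>The two sums differ only in their end terms, so conditions on the limiting behaviour of
  frequencies are \<open>\<phi> 1\<close>-invariant.\<close>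

lemma freq_time_one: "\<bar>freq n W (\<phi> 1 x) - freq n W x\<bar> \<le> 1 / real n"
proof -
  define f where "f j = (indicator W (\<phi> (real j) x) :: real)" for j
  have "(\<Sum>j<n. f (Suc j)) - (\<Sum>j<n. f j) = f n - f 0"
    unfolding sum_subtractf[symmetric] by (rule sum_lessThan_telescope)
  moreover have "\<bar>f n - f 0\<bar> \<le> 1" unfolding f_def by (auto split: split_indicator)
  moreover have "freq n W (\<phi> 1 x) - freq n W x = ((\<Sum>j<n. f (Suc j)) - (\<Sum>j<n. f j)) / real n"
    unfolding freq_def f_def by (simp add: flow_flow diff_divide_distrib add.commute)
  ultimately show ?thesis by (simp add: divide_right_mono)
qed

lemma measurable_freq [measurable]:
  assumes [measurable]: "W \<in> sets borel"
  shows "freq n W \<in> borel_measurable borel"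
  unfolding freq_def[abs_def] by (intro borel_measurable_divide borel_measurable_sum) measurable

text \<open>For a Borel probability \<open>M\<close> this is, by the portmanteau theorem, weak
  convergence to \<open>M\<close> of the empirical measures along the \<open>\<phi> 1\<close>-orbit
  of \<open>x\<close>.\<close>

definition generic :: "'a measure \<Rightarrow> 'a \<Rightarrow> bool" where
  "generic M x \<longleftrightarrow>
     (\<forall>W a. open W \<longrightarrow> a < measure M W \<longrightarrow> eventually (\<lambda>n. a < freq n W x) sequentially)"

text \<open>If \<open>M W\<close> exceeded \<open>N K\<close>, a value \<open>a\<close> between them
  would make the orbit visit \<open>W\<close> with frequency above \<open>a\<close> and the disjoint
  set \<open>- K\<close> with frequency above \<open>1 - a\<close>.\<close>

lemma generic_unique:
  assumes M: "prob_space M" "sets M = sets borel" and N: "prob_space N" "sets N = sets borel"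
    and x: "generic M x" "generic N x"
  shows "M = N"
proof (rule prob_eqI_open_closed[OF M N])
  interpret N: prob_space N by fact
  fix W K :: "'a set" assume WK: "open W" "closed K" "W \<subseteq> K"
  show "measure M W \<le> measure N K"
  proof (rule ccontr)
    assume less: "\<not> measure M W \<le> measure N K"
    define a where "a = (measure M W + measure N K) / 2"
    have "space N = UNIV" using sets_eq_imp_space_eq[OF N(2)] by simp
    then have compl: "measure N (- K) = 1 - measure N K"
      using N.prob_compl[of K] WK(2) N(2) by (simp add: Compl_eq_Diff_UNIV)
    have a: "a < measure M W" "1 - a < measure N (- K)"
      using less compl by (auto simp: a_def field_simps)
    have "eventually (\<lambda>n. a < freq n W x) sequentially"
      using x(1) WK(1) a(1) unfolding generic_def by blast
    moreover have "eventually (\<lambda>n. 1 - a < freq n (- K) x) sequentially"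
      using x(2) open_Compl[OF WK(2)] a(2) unfolding generic_def by blast
    ultimately have "eventually (\<lambda>n. 1 < freq n W x + freq n (- K) x) sequentially"
      by eventually_elim simp
    then obtain n where "1 < freq n W x + freq n (- K) x" by (auto simp: eventually_sequentially)
    then show False using freq_disjoint[of W "- K" n x] WK(3) by auto
  qed
qed

end

locale ergodic_flow = cont_flow \<phi> + prob_space \<mu>
  for \<phi> :: "real \<Rightarrow> 'a::{metric_space, second_countable_topology} \<Rightarrow> 'a" and \<mu> :: "'a measure" +
  assumes sets_mu [measurable_cong]: "sets \<mu> = sets borel"
    and erg: "ergodic (\<phi> 1) \<mu>"
begin

lemma space_mu [simp]: "space \<mu> = UNIV"
  using sets_eq_imp_space_eq[OF sets_mu] by simp

lemma inv1: "invariant_measure (\<phi> 1) \<mu>"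
  using erg by (simp add: ergodic_def)

lemma zero_one:
  assumes B: "B \<in> sets borel" "\<And>x. \<phi> 1 x \<in> B \<longleftrightarrow> x \<in> B"
  shows "(AE x in \<mu>. x \<in> B) \<or> (AE x in \<mu>. x \<notin> B)"
proof -
  have "\<phi> 1 -` B = B" using B(2) by auto
  then have "emeasure \<mu> B = 0 \<or> emeasure \<mu> B = 1"
    using erg B(1) by (simp add: ergodic_def sets_mu)
  then show ?thesis
  proof
    assume "emeasure \<mu> B = 0"
    then show ?thesis using B(1) by (intro disjI2 AE_not_in) (auto simp: null_sets_def sets_mu)
  next
    assume "emeasure \<mu> B = 1"
    then show ?thesis using B(1) by (intro disjI1 AE_prob_1) (simp add: measure_def)
  qed
qed

text \<open>The points with lower frequency at most \<open>a\<close> form an invariant set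
  \<open>B\<close>. If \<open>B\<close> had full measure, take \<open>c\<close> strictly between
  \<open>a\<close> and \<open>\<mu> W\<close>: almost every point would have a positive ergodic sum
  of \<open>c - indicator W\<close>, and the maximal inequality would give
  \<open>\<mu> W \<le> c\<close>. By ergodicity \<open>B\<close> is null.\<close>

lemma AE_freq_gt:
  assumes W: "W \<in> sets borel" and a: "a < measure \<mu> W"
  shows "AE x in \<mu>. eventually (\<lambda>n. a < freq n W x) sequentially"
proof -
  note W[measurable]
  \<comment> \<open>The slack \<open>r\<close> absorbs the change of at most \<open>1 / n\<close>
    under the time-one map, which makes \<open>B\<close> exactly invariant; rational
    \<open>r\<close> keep it Borel.\<close>
  define B where "B = {x. \<forall>r::rat. r > 0 \<longrightarrow> (\<forall>N. \<exists>n\<ge>N. freq n W x < a + of_rat r)}"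
  have B[measurable]: "B \<in> sets borel" unfolding B_def by measurable
  have step: "\<phi> t x \<in> B" if "x \<in> B" and t: "\<And>n x. \<bar>freq n W (\<phi> t x) - freq n W x\<bar> \<le> 1 / real n" for x t
    unfolding B_def
  proof (intro CollectI allI impI)
    fix r :: rat and N :: nat assume r: "r > 0"
    define s :: real where "s = of_rat (r / 2)"
    have s: "s > 0" using r by (simp add: s_def)
    obtain m :: nat where m: "m > 0" "inverse (real m) < s" using ex_inverse_of_nat_less[OF s] by auto
    have "\<And>r N. r > 0 \<Longrightarrow> \<exists>n\<ge>N. freq n W x < a + of_rat r"
      using \<open>x \<in> B\<close> unfolding B_def by blast
    from this[of "r / 2" "max N m"] obtain n where n: "n \<ge> max N m" "freq n W x < a + s"
      using r by (auto simp: s_def)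
    have "1 / real n \<le> inverse (real m)" using n m by (simp add: inverse_eq_divide frac_le)
    then have "freq n W (\<phi> t x) < a + s + s" using t[of n x] n(2) m(2) by linarith
    moreover have "s + s = of_rat r" unfolding s_def of_rat_add[symmetric] by simp
    ultimately show "\<exists>n\<ge>N. freq n W (\<phi> t x) < a + of_rat r"
      using n(1) by (intro exI[of _ n]) (auto simp: add.assoc)
  qed
  have inv: "\<phi> 1 x \<in> B \<longleftrightarrow> x \<in> B" for x
  proof
    assume "\<phi> 1 x \<in> B"
    then have "\<phi> (-1) (\<phi> 1 x) \<in> B"
    proof (rule step)
      fix n y show "\<bar>freq n W (\<phi> (- 1) y) - freq n W y\<bar> \<le> 1 / real n"
        using freq_time_one[of n W "\<phi> (-1) y"] by (simp add: flow_flow abs_minus_commute)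
    qed
    then show "x \<in> B" by (simp add: flow_flow)
  qed (auto intro: step freq_time_one)
  have "\<not> (AE x in \<mu>. x \<in> B)"
  proof
    assume AE: "AE x in \<mu>. x \<in> B"
    obtain r :: rat where r: "r > 0" "of_rat r < measure \<mu> W - a"
      using of_rat_dense[of 0 "measure \<mu> W - a"] a by auto
    define c where "c = a + of_rat r"
    define h where "h x = c - indicator W x" for x
    have [measurable]: "h \<in> borel_measurable \<mu>" unfolding h_def by measurable
    have "(\<integral>x. h x \<partial>\<mu>) \<ge> 0"
    proof (rule maximal_ergodic[OF prob_space_axioms inv1])
      show "\<bar>h x\<bar> \<le> \<bar>c\<bar> + 1" for x by (auto simp: h_def split: split_indicator)
      show "AE x in \<mu>. \<exists>n. (\<Sum>j<n. h ((\<phi> 1 ^^ j) x)) > 0"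
        using AE
      proof eventually_elim
        case (elim x)
        then obtain n where n: "n \<ge> 1" "freq n W x < c" using r unfolding B_def c_def by blast
        have "(\<Sum>j<n. h ((\<phi> 1 ^^ j) x)) = n * (c - freq n W x)"
          using n(1) by (simp add: h_def funpow_flow freq_def sum_subtractf field_simps)
        then show ?case using n by (intro exI[of _ n]) auto
      qed
    qed measurable
    moreover have "integrable \<mu> (\<lambda>x. indicator W x :: real)"
      using W by (intro integrable_real_indicator) (auto simp: sets_mu less_top[symmetric])
    then have "(\<integral>x. h x \<partial>\<mu>) = c - measure \<mu> W"
      unfolding h_def by (simp add: prob_space[unfolded space_mu])
    ultimately show False using r by (simp add: c_def)
  qed
  then have "AE x in \<mu>. x \<notin> B" using zero_one[OF B inv] by blast
  then show ?thesis
  proof eventually_elim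
    case (elim x)
    then obtain r :: rat and N where "r > 0" "\<forall>n\<ge>N. a + of_rat r \<le> freq n W x"
      unfolding B_def by (auto simp: not_less)
    then show ?case unfolding eventually_sequentially
      by (intro exI[of _ N]) (smt (verit, best) zero_less_of_rat_iff)
  qed
qed

lemma generic_set: "{x. generic \<mu> x} \<in> sets borel" and AE_generic: "AE x in \<mu>. generic \<mu> x"
proof -
  obtain \<F> :: "'a set set" where F: "countable \<F>" "\<And>U. U \<in> \<F> \<Longrightarrow> open U"
    "\<And>W a. open W \<Longrightarrow> a < measure \<mu> W \<Longrightarrow> \<exists>U\<in>\<F>. U \<subseteq> W \<and> a < measure \<mu> U"
    using finite_measure_countable_inner_open[OF finite_measure_axioms sets_mu] by metis
  have eq: "generic \<mu> x \<longleftrightarrow>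
    (\<forall>U\<in>\<F>. \<forall>a::rat. of_rat a < measure \<mu> U \<longrightarrow> eventually (\<lambda>n. of_rat a < freq n U x) sequentially)" for x
  proof (intro iffI)
    assume R: "\<forall>U\<in>\<F>. \<forall>a::rat. of_rat a < measure \<mu> U \<longrightarrow>
      eventually (\<lambda>n. of_rat a < freq n U x) sequentially"
    show "generic \<mu> x"
      unfolding generic_def
    proof (intro allI impI)
      fix W :: "'a set" and a assume "open W" "a < measure \<mu> W"
      then obtain U where U: "U \<in> \<F>" "U \<subseteq> W" "a < measure \<mu> U" using F(3) by blast
      obtain q :: rat where q: "a < of_rat q" "of_rat q < measure \<mu> U" using of_rat_dense[OF U(3)] by blast
      have "eventually (\<lambda>n. of_rat q < freq n U x) sequentially" using R U q by blast
      then show "eventually (\<lambda>n. a < freq n W x) sequentially"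
        by eventually_elim (use freq_mono[OF U(2)] q(1) in \<open>meson less_le_trans less_trans\<close>)
    qed
  qed (use F(2) in \<open>auto simp: generic_def\<close>)
  have one: "{x. \<forall>a::rat. of_rat a < measure \<mu> U \<longrightarrow>
      eventually (\<lambda>n. of_rat a < freq n U x) sequentially} \<in> sets borel" if "U \<in> \<F>" for U
  proof -
    note F(2)[OF that, THEN borel_open, measurable]
    show ?thesis unfolding eventually_sequentially by measurable
  qed
  have "{x. generic \<mu> x} = (\<Inter>U\<in>\<F>. {x. \<forall>a::rat. of_rat a < measure \<mu> U \<longrightarrow>
      eventually (\<lambda>n. of_rat a < freq n U x) sequentially})"
    using eq by auto
  also have "\<dots> \<in> sets borel"
  proof (cases "\<F> = {}")
    case False
    then show ?thesis by (intro sets.countable_INT'[OF F(1)]) (use one in blast)+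
  qed simp
  finally show "{x. generic \<mu> x} \<in> sets borel" .
  show "AE x in \<mu>. generic \<mu> x"
    unfolding eq
  proof (intro AE_ball_countable[THEN iffD2] F(1) ballI)
    fix U assume "U \<in> \<F>"
    then have "AE x in \<mu>. of_rat a < measure \<mu> U \<longrightarrow>
        eventually (\<lambda>n. of_rat a < freq n U x) sequentially" for a :: rat
      using AE_freq_gt[of U "of_rat a"] F(2)[of U] by (cases "of_rat a < measure \<mu> U") auto
    then show "AE x in \<mu>. \<forall>a::rat. of_rat a < measure \<mu> U \<longrightarrow>
        eventually (\<lambda>n. of_rat a < freq n U x) sequentially"
      unfolding AE_all_countable by blast
  qed
qed

section \<open>The closed group of times that preserve the measure\<close>

definition symmetries :: "real set" where
  "symmetries = {t. distr \<mu> \<mu> (\<phi> t) = \<mu>}"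

lemma flow_meas [measurable]: "\<phi> t \<in> \<mu> \<rightarrow>\<^sub>M \<mu>"
proof -
  have "(\<lambda>x. \<phi> t x) \<in> borel \<rightarrow>\<^sub>M borel" by measurable
  then show ?thesis using sets_mu by (simp cong: measurable_cong_sets)
qed

lemma distr_flow_distr: "distr (distr \<mu> \<mu> (\<phi> s)) \<mu> (\<phi> t) = distr \<mu> \<mu> (\<phi> (t + s))"
  by (subst distr_distr) (auto simp: comp_def flow_flow)

lemma zero_sym: "0 \<in> symmetries"
proof -
  have "\<phi> 0 = (\<lambda>x. x)" by auto
  then show ?thesis by (simp add: symmetries_def distr_id)
qed

lemma one_sym: "1 \<in> symmetries"
  using inv1 by (simp add: symmetries_def invariant_measure_def)

lemma diff_sym: "s \<in> symmetries \<Longrightarrow> t \<in> symmetries \<Longrightarrow> s - t \<in> symmetries"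
proof -
  have neg: "- t \<in> symmetries" if "t \<in> symmetries" for t
    using distr_flow_distr[of t "-t"] that zero_sym by (simp add: symmetries_def)
  show "s \<in> symmetries \<Longrightarrow> t \<in> symmetries \<Longrightarrow> s - t \<in> symmetries"
    using distr_flow_distr[of "-t" s] neg[of t] by (simp add: symmetries_def)
qed

lemma prob_vimage_sym:
  assumes "t \<in> symmetries" "W \<in> sets borel"
  shows "emeasure \<mu> (\<phi> t -` W) = emeasure \<mu> W"
proof -
  have "emeasure \<mu> W = emeasure (distr \<mu> \<mu> (\<phi> t)) W" using assms by (simp add: symmetries_def)
  also have "\<dots> = emeasure \<mu> (\<phi> t -` W)" using assms by (subst emeasure_distr) (auto simp: sets_mu)
  finally show ?thesis by simp
qed

lemma emeasure_distr_flow: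
  assumes "W \<in> sets borel"
  shows "emeasure (distr \<mu> \<mu> (\<phi> t)) W = (\<integral>\<^sup>+x. indicator W (\<phi> t x) \<partial>\<mu>)"
proof -
  have "(\<integral>\<^sup>+x. indicator W (\<phi> t x) \<partial>\<mu>) = (\<integral>\<^sup>+x. indicator W x \<partial>distr \<mu> \<mu> (\<phi> t))"
    using assms by (subst nn_integral_distr) (auto simp: sets_mu)
  then show ?thesis using assms by (simp add: sets_mu)
qed

text \<open>The indicator of an open set is lower semicontinuous along orbits, so Fatou's lemma
  bounds the image measure at the limit time by \<open>\<mu>\<close> on open sets. Such a bound
  between probability measures forces equality.\<close>

lemma closed_sym: "closed symmetries"
  unfolding closed_sequential_limits
proof (intro allI impI, elim conjE)
  fix s :: "nat \<Rightarrow> real" and t assume s: "\<forall>n. s n \<in> symmetries" "s \<longlonglongrightarrow> t"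
  have "distr \<mu> \<mu> (\<phi> t) = \<mu>"
  proof (rule prob_eqI_open_closed)
    show D: "prob_space (distr \<mu> \<mu> (\<phi> t))" by (rule prob_space_distr) simp
    show "prob_space \<mu>" by (rule prob_space_axioms)
    fix W K :: "'a set" assume WK: "open W" "closed K" "W \<subseteq> K"
    then have [measurable]: "W \<in> sets borel" by simp
    have "emeasure (distr \<mu> \<mu> (\<phi> t)) W = (\<integral>\<^sup>+x. indicator W (\<phi> t x) \<partial>\<mu>)"
      by (rule emeasure_distr_flow) simp
    also have "\<dots> \<le> (\<integral>\<^sup>+x. liminf (\<lambda>n. indicator W (\<phi> (s n) x)) \<partial>\<mu>)"
    proof (rule nn_integral_mono)
      fix x
      show "indicator W (\<phi> t x) \<le> (liminf (\<lambda>n. indicator W (\<phi> (s n) x)) :: ennreal)"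
      proof (cases "\<phi> t x \<in> W")
        case True
        have "continuous_on UNIV (\<lambda>t. \<phi> t x)" by (intro continuous_intros)
        then have "(\<lambda>n. \<phi> (s n) x) \<longlonglongrightarrow> \<phi> t x"
          using s(2) by (auto intro: continuous_on_tendsto_compose)
        then have "eventually (\<lambda>n. \<phi> (s n) x \<in> W) sequentially"
          using WK(1) True by (rule topological_tendstoD)
        then have "eventually (\<lambda>n. 1 \<le> (indicator W (\<phi> (s n) x) :: ennreal)) sequentially"
          by eventually_elim simp
        then show ?thesis using True by (auto intro: Liminf_bounded)
      qed simp
    qed
    also have "\<dots> \<le> liminf (\<lambda>n. \<integral>\<^sup>+x. indicator W (\<phi> (s n) x) \<partial>\<mu>)"
      by (intro nn_integral_liminf) simp
    also have "(\<lambda>n. \<integral>\<^sup>+x. indicator W (\<phi> (s n) x) \<partial>\<mu>) = (\<lambda>n. emeasure \<mu> W)"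
    proof
      fix n
      have "(\<integral>\<^sup>+x. indicator W (\<phi> (s n) x) \<partial>\<mu>) = emeasure (distr \<mu> \<mu> (\<phi> (s n))) W"
        by (rule emeasure_distr_flow[symmetric]) simp
      then show "(\<integral>\<^sup>+x. indicator W (\<phi> (s n) x) \<partial>\<mu>) = emeasure \<mu> W" using s(1) by (simp add: symmetries_def)
    qed
    also have "liminf (\<lambda>n. emeasure \<mu> W) \<le> emeasure \<mu> K"
      using WK by (simp add: Liminf_const emeasure_mono sets_mu)
    finally show "measure (distr \<mu> \<mu> (\<phi> t)) W \<le> measure \<mu> K"
      by (simp add: emeasure_eq_measure finite_measure.emeasure_eq_measure[OF prob_space.finite_measure[OF D]])
  qed (simp_all add: sets_mu)
  then show "t \<in> symmetries" by (simp add: symmetries_def)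
qed

text \<open>If \<open>\<phi> t x\<close> is generic for \<open>\<mu>\<close>, then \<open>x\<close>
  is generic for the image of \<open>\<mu>\<close> under \<open>\<phi> (- t)\<close>. Since
  \<open>x\<close> is also generic for \<open>\<mu>\<close>, the two measures agree. A single
  generic orbit thus detects the whole symmetry group.\<close>

lemma generic_flow_iff:
  assumes "generic \<mu> x"
  shows "generic \<mu> (\<phi> t x) \<longleftrightarrow> t \<in> symmetries"
proof
  assume gen: "generic \<mu> (\<phi> t x)"
  have "distr \<mu> \<mu> (\<phi> (-t)) = \<mu>"
  proof (rule generic_unique)
    show "prob_space (distr \<mu> \<mu> (\<phi> (-t)))" by (rule prob_space_distr) simp
    show "generic (distr \<mu> \<mu> (\<phi> (- t))) x"
      unfolding generic_def
    proof (intro allI impI)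
      fix V :: "'a set" and a assume V: "open V" "a < measure (distr \<mu> \<mu> (\<phi> (- t))) V"
      have "V \<in> sets \<mu>" using V(1) by (simp add: sets_mu)
      then have "a < measure \<mu> (\<phi> (- t) -` V)"
        using V(2) measure_distr[OF flow_meas, of V "- t"] by simp
      then have "eventually (\<lambda>n. a < freq n (\<phi> (- t) -` V) (\<phi> t x)) sequentially"
        using gen open_vimage_flow[OF V(1)] unfolding generic_def by blast
      then show "eventually (\<lambda>n. a < freq n V x) sequentially"
        by (simp add: freq_flow vimage_def flow_flow)
    qed
  qed (use assms prob_space_axioms in \<open>auto simp: sets_mu\<close>)
  then have "- t \<in> symmetries" by (simp add: symmetries_def)
  then show "t \<in> symmetries" using diff_sym[OF zero_sym, of "- t"] by simp
next
  assume t: "t \<in> symmetries"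
  show "generic \<mu> (\<phi> t x)"
    unfolding generic_def freq_flow
  proof (intro allI impI)
    fix W :: "'a set" and a assume W: "open W" "a < measure \<mu> W"
    then have "a < measure \<mu> (\<phi> t -` W)" using prob_vimage_sym[OF t, of W] by (simp add: measure_def)
    then show "eventually (\<lambda>n. a < freq n (\<phi> t -` W) x) sequentially"
      using assms open_vimage_flow[OF W(1)] unfolding generic_def by blast
  qed
qed

end

subsection \<open>Orbits that meet the generic set in a discrete set\<close>

text \<open>Serves to compare the number of \<open>\<phi> 1\<close>-orbits on different leaves,
  which may have no points in common but show the same pattern of coincidences.\<close>

lemma card_image_eq_kernel:
  assumes "\<And>i j. i \<in> S \<Longrightarrow> j \<in> S \<Longrightarrow> f i = f j \<longleftrightarrow> g i = g j"
  shows "card (f ` S) = card (g ` S)"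
proof (rule bij_betw_same_card)
  define h where "h y = g (inv_into S f y)" for y
  have h: "h (f i) = g i" if "i \<in> S" for i
    unfolding h_def using that assms by (metis f_inv_into_f image_eqI inv_into_into)
  have "inj_on h (f ` S)" using h assms by (auto simp: inj_on_def)
  moreover have "h ` f ` S = g ` S" using h by force
  ultimately show "bij_betw h (f ` S) (g ` S)" by (simp add: bij_betw_def)
qed

context cont_flow
begin

text \<open>Removing \<open>D - S\<close> from the orbit leaves a leaf-open set that cuts
  \<open>S\<close> out of \<open>D\<close>. Closedness is asked of all sets of times because a
  uniform gap between times passes to subsets.\<close>

lemma discrete_in_leafI:
  assumes D: "D \<subseteq> orbit \<phi> x" and cl: "\<And>S. S \<subseteq> {t. \<phi> t x \<in> D} \<Longrightarrow> closed S"
  shows "discrete_in_leaf \<phi> x D"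
proof -
  have "openin (subtopology (leaf_topology \<phi> x) D) S" if S: "S \<subseteq> D" for S
    unfolding openin_subtopology
  proof (intro exI conjI)
    have "closed {t. \<phi> t x \<in> D - S}" by (rule cl) auto
    then have "open (- {t. \<phi> t x \<in> D - S})" by (rule open_Compl)
    also have "- {t. \<phi> t x \<in> D - S} = {t. \<phi> t x \<in> orbit \<phi> x - (D - S)}" by auto
    finally show "openin (leaf_topology \<phi> x) (orbit \<phi> x - (D - S))"
      by (auto simp: openin_leaf_topology)
    show "S = (orbit \<phi> x - (D - S)) \<inter> D" using S D by auto
  qed
  then have "openin (subtopology (leaf_topology \<phi> x) D) S \<longleftrightarrow> openin (discrete_topology D) S" for S
    using openin_subset[of "subtopology (leaf_topology \<phi> x) D" S] D
    by (auto simp: topspace_leaf_topology)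
  then show ?thesis using D by (simp add: discrete_in_leaf_def topology_eq)
qed

lemma closed_fixed: "closed {x. \<forall>t. \<phi> t x = x}"
proof -
  have "closed {x. \<phi> t x = x}" for t
    by (intro closed_Collect_eq continuous_intros)
  then have "closed (\<Inter>t. {x. \<phi> t x = x})" by blast
  also have "(\<Inter>t. {x. \<phi> t x = x}) = {x. \<forall>t. \<phi> t x = x}" by auto
  finally show ?thesis .
qed

end

lemma (in prob_space) AE_imp_ex:
  assumes "AE x in M. P x"
  shows "\<exists>x. P x"
proof (rule ccontr)
  assume "\<nexists>x. P x"
  then have "AE x in M. False" using assms by simp
  then show False by simp
qed

context ergodic_flow
begin

text \<open>On the invariant set \<open>F\<close> of fixed points \<open>\<phi> 1\<close> is the
  identity. If \<open>F\<close> has full measure, ergodicity therefore gives every Borel set measure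
  0 or 1, and in a second countable metric space such a measure is a Dirac measure.\<close>

lemma fixed_cases:
  "(AE x in \<mu>. \<not> (\<forall>t. \<phi> t x = x)) \<or> (\<exists>x0. (\<forall>t. \<phi> t x0 = x0) \<and> (AE x in \<mu>. x = x0))"
proof -
  define F where "F = {x. \<forall>t. \<phi> t x = x}"
  have F: "F \<in> sets borel" unfolding F_def using closed_fixed by simp
  have inF: "\<phi> 1 x \<in> F \<longleftrightarrow> x \<in> F" for x
  proof
    assume "\<phi> 1 x \<in> F"
    then have "\<phi> (-1) (\<phi> 1 x) = \<phi> 1 x" by (auto simp: F_def)
    then have "\<phi> 1 x = x" by (simp add: flow_flow)
    with \<open>\<phi> 1 x \<in> F\<close> show "x \<in> F" by simp
  qed (auto simp: F_def)
  show ?thesis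
  proof (cases "AE x in \<mu>. x \<in> F")
    case False
    then have "AE x in \<mu>. x \<notin> F" using zero_one[OF F inF] by blast
    then show ?thesis by (simp add: F_def)
  next
    case True
    have dich: "(AE x in \<mu>. x \<in> U) \<or> (AE x in \<mu>. x \<notin> U)" if "U \<in> sets borel" for U
    proof -
      have "\<phi> 1 x \<in> U \<inter> F \<longleftrightarrow> x \<in> U \<inter> F" for x using inF by (auto simp: F_def)
      then have "(AE x in \<mu>. x \<in> U \<inter> F) \<or> (AE x in \<mu>. x \<notin> U \<inter> F)"
        using zero_one[of "U \<inter> F"] F that by blast
      then show ?thesis
      proof
        assume "AE x in \<mu>. x \<in> U \<inter> F"
        then have "AE x in \<mu>. x \<in> U" by eventually_elim auto
        then show ?thesis ..
      next
        assume "AE x in \<mu>. x \<notin> U \<inter> F"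
        with True have "AE x in \<mu>. x \<notin> U" by eventually_elim auto
        then show ?thesis ..
      qed
    qed
    obtain B :: "'a set set" where B: "countable B" "topological_basis B"
      using ex_countable_basis by blast
    \<comment> \<open>Almost every point avoids all null basic open sets; any such point of
      \<open>F\<close> is the atom, since every other point is excluded by a basic neighbourhood of
      it of full measure.\<close>
    have "AE x in \<mu>. x \<in> F \<and> (\<forall>U\<in>B. x \<in> U \<longrightarrow> (AE y in \<mu>. y \<in> U))"
    proof (intro AE_conjI True AE_ball_countable[THEN iffD2] B ballI)
      fix U assume "U \<in> B"
      then have "U \<in> sets borel" using topological_basis_open[OF B(2)] by simp
      from dich[OF this] show "AE x in \<mu>. x \<in> U \<longrightarrow> (AE y in \<mu>. y \<in> U)"
      proof
        assume "AE x in \<mu>. x \<notin> U"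
        then show ?thesis by eventually_elim simp
      qed simp
    qed
    then have "\<exists>x. x \<in> F \<and> (\<forall>U\<in>B. x \<in> U \<longrightarrow> (AE y in \<mu>. y \<in> U))"
      by (rule AE_imp_ex)
    then obtain x0 where x0: "x0 \<in> F" "\<And>U. U \<in> B \<Longrightarrow> x0 \<in> U \<Longrightarrow> AE y in \<mu>. y \<in> U" by blast
    have "AE y in \<mu>. \<forall>U\<in>B. x0 \<in> U \<longrightarrow> y \<in> U"
    proof (intro AE_ball_countable[THEN iffD2] B ballI)
      fix U assume "U \<in> B"
      then show "AE y in \<mu>. x0 \<in> U \<longrightarrow> y \<in> U" using x0(2)[of U] by (cases "x0 \<in> U") simp_all
    qed
    then have "AE y in \<mu>. y = x0"
    proof eventually_elim
      case (elim y)
      show ?case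
      proof (rule ccontr)
        assume "y \<noteq> x0"
        then have "open (- {y})" "x0 \<in> - {y}" by auto
        then obtain U where "U \<in> B" "x0 \<in> U" "U \<subseteq> - {y}" using topological_basisE[OF B(2)] by metis
        then show False using elim by auto
      qed
    qed
    then show ?thesis using x0(1) unfolding F_def by blast
  qed
qed

lemma transversal_of_fixed_point:
  assumes x0: "\<forall>t. \<phi> t x0 = x0" "AE x in \<mu>. x = x0"
  shows "AE x in \<mu>. discrete_in_leaf \<phi> x (orbit \<phi> x \<inter> {x0})"
    "AE x in \<mu>. \<exists>C. C \<subseteq> range (time_one_orbit \<phi>) \<and> card C = 1 \<and> orbit \<phi> x \<inter> {x0} = \<Union>C"
proof -
  have orb: "orbit \<phi> x0 = {x0}" "time_one_orbit \<phi> x0 = {x0}"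
    using x0(1) by (auto simp: orbit_def time_one_orbit_def)
  have "S = {} \<or> S = {x0}" if "S \<subseteq> {x0}" for S using that by auto
  then have "openin (subtopology (leaf_topology \<phi> x0) {x0}) S \<longleftrightarrow> S \<subseteq> {x0}" for S
    using openin_topspace[of "subtopology (leaf_topology \<phi> x0) {x0}"] openin_subset
    by (metis openin_empty inf.idem orb(1) topspace_leaf_topology topspace_subtopology)
  then have d: "discrete_in_leaf \<phi> x0 {x0}"
    by (auto simp: discrete_in_leaf_def topology_eq orb)
  from x0(2) show "AE x in \<mu>. discrete_in_leaf \<phi> x (orbit \<phi> x \<inter> {x0})"
    by eventually_elim (simp add: orb d)
  have C: "\<exists>C. C \<subseteq> range (time_one_orbit \<phi>) \<and> card C = 1 \<and> orbit \<phi> x0 \<inter> {x0} = \<Union>C"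
    using rangeI[of "time_one_orbit \<phi>" x0] by (intro exI[of _ "{{x0}}"]) (simp add: orb)
  from x0(2) show "AE x in \<mu>. \<exists>C. C \<subseteq> range (time_one_orbit \<phi>) \<and> card C = 1 \<and> orbit \<phi> x \<inter> {x0} = \<Union>C"
    by eventually_elim (use C in blast)
qed

text \<open>The generic times on a generic orbit are the multiples of \<open>p\<close>, which are
  \<open>p\<close> apart. Modulo 1 they have \<open>q\<close> representatives, so there are at most
  \<open>q\<close> time-one orbits; there are fewer if a period of the flow identifies some of them.
  Which ones coincide is invariant under \<open>\<phi> 1\<close>, so the pattern, and with it the
  number \<open>k\<close>, is almost surely constant.\<close>

lemma transversal_generic:
  assumes "symmetries \<noteq> UNIV"
  shows "AE x in \<mu>. discrete_in_leaf \<phi> x (orbit \<phi> x \<inter> {y. generic \<mu> y})"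
    "\<exists>k\<ge>1. AE x in \<mu>. \<exists>C. C \<subseteq> range (time_one_orbit \<phi>) \<and> card C = k \<and>
       orbit \<phi> x \<inter> {y. generic \<mu> y} = \<Union>C"
proof -
  define A where "A = {y. generic \<mu> y}"
  obtain p :: real where p: "p \<ge> 0" "symmetries = range (\<lambda>n::int. of_int n * p)"
    using closed_additive_subgroup_real[OF closed_sym zero_sym diff_sym] assms by blast
  \<comment> \<open>As 1 is a symmetry, \<open>p\<close> is the reciprocal of an integer
    \<open>q'\<close>; in particular \<open>p\<close> is not 0.\<close>
  obtain q' :: int where q': "of_int q' * p = 1" using one_sym p(2) by auto
  have p0: "p > 0" using q' p(1) by (cases "p = 0") auto
  have q'0: "q' > 0" using q' p0 by (metis less_irrefl mult_nonpos_nonneg not_le of_int_0_less_iff p(1) zero_less_one)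
  define q where "q = nat q'"
  have q: "q > 0" "int q = q'" using q'0 by (auto simp: q_def)
  have inA: "\<phi> t x \<in> A \<longleftrightarrow> t \<in> symmetries" if "x \<in> A" for x t
    using that generic_flow_iff by (simp add: A_def)
  have AE_A: "AE x in \<mu>. x \<in> A" using AE_generic by (simp add: A_def)
  from AE_A have "AE x in \<mu>. discrete_in_leaf \<phi> x (orbit \<phi> x \<inter> A)"
  proof eventually_elim
    case (elim x)
    show ?case
    proof (rule discrete_in_leafI)
      fix S assume "S \<subseteq> {t. \<phi> t x \<in> orbit \<phi> x \<inter> A}"
      then have "S \<subseteq> symmetries" using inA[OF elim] by auto
      show "closed S"
      proof (rule discrete_imp_closed[OF p0], intro ballI impI)
        fix s t assume "s \<in> S" "t \<in> S" "dist t s < p"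
        then obtain m n :: int where mn: "s = of_int m * p" "t = of_int n * p"
          using \<open>S \<subseteq> symmetries\<close> p(2) by blast
        have "dist t s = \<bar>of_int (n - m)\<bar> * p"
          using p0 by (simp add: mn dist_real_def left_diff_distrib[symmetric] abs_mult)
        then have "\<bar>of_int (n - m) :: real\<bar> < 1" using \<open>dist t s < p\<close> p0 by simp
        then have "n = m" by linarith
        then show "t = s" using mn by simp
      qed
    qed simp
  qed
  then show "AE x in \<mu>. discrete_in_leaf \<phi> x (orbit \<phi> x \<inter> {y. generic \<mu> y})" by (simp add: A_def)
  \<comment> \<open>The candidates: the time-one orbits through the generic times
    \<open>0, p, 2 p, ...\<close>, of which the first \<open>q\<close> suffice.\<close>
  define f where "f x i = time_one_orbit \<phi> (\<phi> (real i * p) x)" for x i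
  have f_eq: "f x i = f x j \<longleftrightarrow> (\<exists>n::int. \<phi> (real i * p) x = \<phi> (of_int n + real j * p) x)" for x i j
    unfolding f_def time_one_orbit_eq_iff flow_flow ..
  have f_range: "\<exists>i<q. time_one_orbit \<phi> (\<phi> t x) = f x i" if "t \<in> symmetries" for x t
  proof -
    obtain n :: int where n: "t = of_int n * p" using \<open>t \<in> symmetries\<close> p(2) by auto
    have "nat (n mod q') < q" using q'0 by (simp add: q_def)
    moreover have "n mod q' \<ge> 0" using q'0 by simp
    have "of_int n * p = of_int (n div q') * (of_int q' * p) + of_int (n mod q') * p"
      by (metis distrib_right mult.assoc of_int_add of_int_mult div_mult_mod_eq)
    then have "t = of_int (n div q') + real (nat (n mod q')) * p"
      using \<open>n mod q' \<ge> 0\<close> n q' by simp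
    then have "time_one_orbit \<phi> (\<phi> t x) = f x (nat (n mod q'))"
      unfolding f_def time_one_orbit_eq_iff by (auto simp: flow_flow)
    ultimately show ?thesis by blast
  qed
  have mult_sym: "real i * p \<in> symmetries" for i
    using p(2) by (auto intro!: image_eqI[of _ _ "int i"])
  have int_sym: "of_int n \<in> symmetries" for n
  proof -
    have "of_int n = of_int (n * q') * p" using q' by (simp add: mult.assoc)
    then show ?thesis unfolding p(2) by blast
  qed
  have cover: "orbit \<phi> x \<inter> A = \<Union> (f x ` {..<q})" if xA: "x \<in> A" for x
  proof (intro set_eqI iffI)
    fix y assume "y \<in> orbit \<phi> x \<inter> A"
    then obtain t where t: "y = \<phi> t x" "t \<in> symmetries" using inA[OF xA] by (auto simp: orbit_def)
    have "y \<in> time_one_orbit \<phi> y"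
      unfolding time_one_orbit_def by (auto intro: image_eqI[of _ _ 0])
    then show "y \<in> \<Union> (f x ` {..<q})" using f_range[OF t(2), of x] t(1) by auto
  next
    fix y assume "y \<in> \<Union> (f x ` {..<q})"
    then obtain i and n :: int where y: "y = \<phi> (of_int n) (\<phi> (real i * p) x)"
      by (auto simp: f_def time_one_orbit_def)
    have "\<phi> (real i * p) x \<in> A" using inA[OF that] mult_sym by blast
    then have "y \<in> A" unfolding y using inA int_sym by blast
    then show "y \<in> orbit \<phi> x \<inter> A" by (simp add: y flow_flow)
  qed
  \<comment> \<open>The almost sure pattern of coincidences. It is read off at one point
    \<open>x1\<close> to define \<open>k\<close>.\<close>
  define R where "R i j \<longleftrightarrow> (AE x in \<mu>. f x i = f x j)" for i j
  have dich: "AE x in \<mu>. f x i = f x j \<longleftrightarrow> R i j" for i j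
  proof -
    have cl: "closed {x. \<phi> (real i * p) x = \<phi> (of_int n + real j * p) x}" for n :: int
      by (intro closed_Collect_eq continuous_intros)
    have "{x. f x i = f x j} = (\<Union>n::int. {x. \<phi> (real i * p) x = \<phi> (of_int n + real j * p) x})"
      unfolding f_eq by auto
    also have "\<dots> \<in> sets borel" using cl by (intro sets.countable_UN) auto
    finally have B: "{x. f x i = f x j} \<in> sets borel" .
    have "f (\<phi> 1 x) i = f x i" for x i
      unfolding f_def time_one_orbit_eq_iff flow_flow by (intro exI[of _ 1]) (simp add: add.commute)
    then have "(AE x in \<mu>. x \<in> {x. f x i = f x j}) \<or> (AE x in \<mu>. x \<notin> {x. f x i = f x j})"
      by (intro zero_one B) auto
    then show ?thesis
    proof
      assume ae: "AE x in \<mu>. x \<in> {x. f x i = f x j}"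
      then have "R i j" by (simp add: R_def)
      with ae show ?thesis by simp
    next
      assume ae: "AE x in \<mu>. x \<notin> {x. f x i = f x j}"
      have "\<not> R i j"
      proof
        assume "R i j"
        then have "AE x in \<mu>. False" unfolding R_def using ae by eventually_elim simp
        then show False by simp
      qed
      with ae show ?thesis by simp
    qed
  qed
  have R: "AE x in \<mu>. \<forall>i\<in>{..<q}. \<forall>j\<in>{..<q}. f x i = f x j \<longleftrightarrow> R i j"
    by (intro AE_ball_countable[THEN iffD2] ballI dich) auto
  have "\<exists>x. \<forall>i\<in>{..<q}. \<forall>j\<in>{..<q}. f x i = f x j \<longleftrightarrow> R i j"
    using R by (rule AE_imp_ex)
  then obtain x1 where x1: "\<forall>i\<in>{..<q}. \<forall>j\<in>{..<q}. f x1 i = f x1 j \<longleftrightarrow> R i j" ..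
  define k where "k = card (f x1 ` {..<q})"
  have "k \<ge> 1" using q(1) by (auto simp: k_def Suc_le_eq card_gt_0_iff)
  moreover have "AE x in \<mu>. \<exists>C. C \<subseteq> range (time_one_orbit \<phi>) \<and> card C = k \<and> orbit \<phi> x \<inter> A = \<Union>C"
    using R AE_A
  proof eventually_elim
    case (elim x)
    have "card (f x ` {..<q}) = k"
      unfolding k_def using elim(1) x1 by (intro card_image_eq_kernel) blast
    moreover have "f x ` {..<q} \<subseteq> range (time_one_orbit \<phi>)" by (auto simp: f_def)
    ultimately show ?case using cover[OF elim(2)] by blast
  qed
  ultimately show "\<exists>k\<ge>1. AE x in \<mu>. \<exists>C. C \<subseteq> range (time_one_orbit \<phi>) \<and> card C = k \<and>
       orbit \<phi> x \<inter> {y. generic \<mu> y} = \<Union>C"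
    unfolding A_def by blast
qed

end

subsection \<open>The leaf measures\<close>

lemma emeasure_lborel_translate:
  fixes c :: real
  assumes "A \<in> sets borel"
  shows "emeasure lborel {s. c + s \<in> A} = emeasure lborel A"
proof -
  have "emeasure lborel A = emeasure (distr lborel borel ((+) c)) A"
    by (simp only: lborel_distr_plus)
  also have "\<dots> = emeasure lborel {s. c + s \<in> A}"
    using assms by (subst emeasure_distr) (auto simp: vimage_def)
  finally show ?thesis by simp
qed

lemma emeasure_lborel_reflect:
  assumes "A \<in> sets (borel :: real measure)"
  shows "emeasure lborel {s. - s \<in> A} = emeasure lborel A"
proof -
  have "emeasure lborel A = emeasure (distr lborel borel uminus) A"
    by (simp only: lborel_distr_uminus)
  also have "\<dots> = emeasure lborel {s. - s \<in> A}"
    using assms by (subst emeasure_distr) (auto simp: vimage_def)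
  finally show ?thesis by simp
qed

context cont_flow
begin

lemma stabilizer_eq: "\<phi> s x = \<phi> t x \<longleftrightarrow> \<phi> (s - t) x = x"
proof
  assume "\<phi> s x = \<phi> t x"
  then have "\<phi> (- t) (\<phi> s x) = \<phi> (- t) (\<phi> t x)" by simp
  then show "\<phi> (s - t) x = x" by (simp add: flow_flow)
next
  assume "\<phi> (s - t) x = x"
  then have "\<phi> t (\<phi> (s - t) x) = \<phi> t x" by simp
  then show "\<phi> s x = \<phi> t x" by (simp add: flow_flow)
qed

text \<open>\<open>p = 0\<close> is the case of an injective orbit; otherwise \<open>p\<close> is
  the least period.\<close>

lemma stabilizer_cases:
  assumes "\<not> (\<forall>t. \<phi> t x = x)"
  obtains p where "p \<ge> 0" "{t. \<phi> t x = x} = range (\<lambda>n::int. of_int n * p)"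
proof -
  have "closed {t. \<phi> t x = x}" by (intro closed_Collect_eq continuous_intros)
  moreover have "s - t \<in> {t. \<phi> t x = x}" if "s \<in> {t. \<phi> t x = x}" "t \<in> {t. \<phi> t x = x}" for s t
    using that stabilizer_eq[of s x t] by simp
  ultimately have "{t. \<phi> t x = x} = UNIV \<or> (\<exists>p\<ge>0. {t. \<phi> t x = x} = range (\<lambda>n::int. of_int n * p))"
    by (intro closed_additive_subgroup_real) simp_all
  then show ?thesis using assms that by blast
qed

text \<open>The whole line for an injective orbit, \<open>[0, p)\<close> for one of least period
  \<open>p\<close>. Pushing all of Lebesgue measure onto a periodic orbit would cover it infinitely
  often.\<close>

lemma fundamental_domain:
  assumes "\<not> (\<forall>t. \<phi> t x = x)"
  obtains D where "D \<in> sets borel" "bij_betw (\<lambda>s. \<phi> s x) D (orbit \<phi> x)"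
proof -
  obtain p where p: "p \<ge> 0" "{t. \<phi> t x = x} = range (\<lambda>n::int. of_int n * p)"
    using stabilizer_cases[OF assms] .
  have per: "\<phi> t x = x \<longleftrightarrow> (\<exists>n::int. t = of_int n * p)" for t
    using p(2) by blast
  show ?thesis
  proof (cases "p = 0")
    case True
    have "inj (\<lambda>s. \<phi> s x)"
      using per True by (auto simp: inj_on_def stabilizer_eq[of _ x])
    then show ?thesis by (intro that[of UNIV]) (auto simp: bij_betw_def orbit_def)
  next
    case False
    then have p0: "p > 0" using p(1) by simp
    have "inj_on (\<lambda>s. \<phi> s x) {0..<p}"
    proof (rule inj_onI)
      fix s t assume st: "s \<in> {0..<p}" "t \<in> {0..<p}" "\<phi> s x = \<phi> t x"
      then obtain n :: int where n: "s - t = of_int n * p" using per stabilizer_eq by blast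
      then have "- 1 * p < of_int n * p" "of_int n * p < 1 * p" unfolding n[symmetric] using st by auto
      then have "- 1 < (of_int n :: real)" "(of_int n :: real) < 1"
        using p0 by (simp_all only: mult_less_cancel_right_pos)
      then have "n = 0" by linarith
      then show "s = t" using n by simp
    qed
    moreover have "\<phi> t x \<in> (\<lambda>s. \<phi> s x) ` {0..<p}" for t
    proof (rule image_eqI)
      show "t - of_int \<lfloor>t / p\<rfloor> * p \<in> {0..<p}"
        using floor_divide_lower[OF p0, of t] floor_divide_upper[OF p0, of t] by (auto simp: algebra_simps)
      show "\<phi> t x = \<phi> (t - of_int \<lfloor>t / p\<rfloor> * p) x"
        using per by (subst stabilizer_eq) auto
    qed
    ultimately show ?thesis by (intro that[of "{0..<p}"]) (auto simp: bij_betw_def orbit_def)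
  qed
qed

text \<open>Cut each of the two sets into countably many pieces that are translates of each other by
  elements of the stabilizer of \<open>x\<close>.\<close>

lemma emeasure_lborel_section_eq:
  assumes x: "\<not> (\<forall>t. \<phi> t x = x)"
    and D: "D \<in> sets borel" "inj_on (\<lambda>s. \<phi> s x) D"
    and E: "E \<in> sets borel" "inj_on (\<lambda>s. \<phi> s x) E"
    and eq: "(\<lambda>s. \<phi> s x) ` D = (\<lambda>s. \<phi> s x) ` E"
  shows "emeasure lborel D = emeasure lborel E"
proof -
  note D(1)[measurable] E(1)[measurable]
  define \<Gamma> where "\<Gamma> = {t. \<phi> t x = x}"
  obtain p where "\<Gamma> = range (\<lambda>n::int. of_int n * p)"
    using stabilizer_cases[OF x] unfolding \<Gamma>_def by metis
  then have cnt: "countable \<Gamma>" by simp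
  have "D = (\<Union>c\<in>\<Gamma>. {s. s \<in> D \<and> s - c \<in> E})"
  proof (intro set_eqI iffI)
    fix s assume "s \<in> D"
    then obtain e where "e \<in> E" "\<phi> s x = \<phi> e x" using eq by (metis (no_types, lifting) image_iff)
    then have "s - e \<in> \<Gamma>" "s - (s - e) \<in> E" using stabilizer_eq by (auto simp: \<Gamma>_def)
    then show "s \<in> (\<Union>c\<in>\<Gamma>. {s. s \<in> D \<and> s - c \<in> E})" using \<open>s \<in> D\<close> by blast
  qed auto
  then have "emeasure lborel D = emeasure lborel (\<Union>c\<in>\<Gamma>. {s. s \<in> D \<and> s - c \<in> E})" by simp
  also have "\<dots> = (\<integral>\<^sup>+c. emeasure lborel {s. s \<in> D \<and> s - c \<in> E} \<partial>count_space \<Gamma>)"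
  proof (rule emeasure_UN_countable[OF _ cnt])
    show "disjoint_family_on (\<lambda>c. {s. s \<in> D \<and> s - c \<in> E}) \<Gamma>"
    proof (unfold disjoint_family_on_def, intro ballI impI)
      fix c d assume cd: "c \<in> \<Gamma>" "d \<in> \<Gamma>" "c \<noteq> d"
      have False if "s - c \<in> E" "s - d \<in> E" for s
      proof -
        have "\<phi> (d - c) x = x" using cd stabilizer_eq[of d x c] by (simp add: \<Gamma>_def)
        then have "\<phi> (s - c) x = \<phi> (s - d) x" by (subst stabilizer_eq) simp
        then show False using inj_onD[OF E(2) _ that] cd(3) by simp
      qed
      then show "{s. s \<in> D \<and> s - c \<in> E} \<inter> {s. s \<in> D \<and> s - d \<in> E} = {}" by blast
    qed
  qed simp
  \<comment> \<open>Translation by \<open>c\<close> turns the piece of \<open>D\<close> with index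
    \<open>c\<close> into a piece of \<open>E\<close>; these pieces are again disjoint, now because
    the orbit map is injective on \<open>D\<close>.\<close>
  also have "\<dots> = (\<integral>\<^sup>+c. emeasure lborel {s. s \<in> E \<and> c + s \<in> D} \<partial>count_space \<Gamma>)"
  proof (rule nn_integral_cong)
    fix c
    have "emeasure lborel {s. s \<in> D \<and> s - c \<in> E} = emeasure lborel {s. c + s \<in> {s. s \<in> D \<and> s - c \<in> E}}"
      by (rule emeasure_lborel_translate[symmetric]) measurable
    also have "{s. c + s \<in> {s. s \<in> D \<and> s - c \<in> E}} = {s. s \<in> E \<and> c + s \<in> D}" by auto
    finally show "emeasure lborel {s. s \<in> D \<and> s - c \<in> E} = emeasure lborel {s. s \<in> E \<and> c + s \<in> D}" .
  qed
  also have "\<dots> = emeasure lborel (\<Union>c\<in>\<Gamma>. {s. s \<in> E \<and> c + s \<in> D})"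
  proof (rule emeasure_UN_countable[OF _ cnt, symmetric])
    show "disjoint_family_on (\<lambda>c. {s. s \<in> E \<and> c + s \<in> D}) \<Gamma>"
    proof (unfold disjoint_family_on_def, intro ballI impI)
      fix c d assume cd: "c \<in> \<Gamma>" "d \<in> \<Gamma>" "c \<noteq> d"
      have False if "c + s \<in> D" "d + s \<in> D" for s
      proof -
        have "\<phi> (c - d) x = x" using cd stabilizer_eq[of c x d] by (simp add: \<Gamma>_def)
        then have "\<phi> (c + s) x = \<phi> (d + s) x" by (subst stabilizer_eq) simp
        then show False using inj_onD[OF D(2) _ that] cd(3) by simp
      qed
      then show "{s. s \<in> E \<and> c + s \<in> D} \<inter> {s. s \<in> E \<and> d + s \<in> D} = {}" by blast
    qed
  qed simp
  also have "(\<Union>c\<in>\<Gamma>. {s. s \<in> E \<and> c + s \<in> D}) = E"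
  proof (intro set_eqI iffI)
    fix s assume "s \<in> E"
    then obtain d where "d \<in> D" "\<phi> d x = \<phi> s x" using eq by (metis (no_types, lifting) image_iff)
    then have "d - s \<in> \<Gamma>" "(d - s) + s \<in> D" using stabilizer_eq by (auto simp: \<Gamma>_def)
    then show "s \<in> (\<Union>c\<in>\<Gamma>. {s. s \<in> E \<and> c + s \<in> D})" using \<open>s \<in> E\<close> by blast
  qed auto
  finally show ?thesis .
qed

text \<open>Half the length of time. Since the measure is indexed by the leaf as a set, a base point
  and a section have to be chosen; \<open>emeasure_leaf_measure\<close> shows that the choice does
  not matter.\<close>

definition leaf_measure :: "'a set \<Rightarrow> 'a measure" where
  "leaf_measure L =
     (let (x, D) = (SOME (x, D). orbit \<phi> x = L \<and> D \<in> sets borel \<and> bij_betw (\<lambda>s. \<phi> s x) D L)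
      in scale_measure (1 / 2) (distr (restrict_space lborel D) (restrict_space borel L) (\<lambda>s. \<phi> s x)))"

lemma leaf_measure_rep:
  assumes "\<not> (\<forall>t. \<phi> t x = x)"
  obtains y D where "orbit \<phi> y = orbit \<phi> x" "D \<in> sets borel" "bij_betw (\<lambda>s. \<phi> s y) D (orbit \<phi> x)"
    "leaf_measure (orbit \<phi> x) =
       scale_measure (1 / 2) (distr (restrict_space lborel D) (restrict_space borel (orbit \<phi> x)) (\<lambda>s. \<phi> s y))"
proof -
  define P where "P = (\<lambda>(y, D). orbit \<phi> y = orbit \<phi> x \<and> D \<in> sets borel \<and> bij_betw (\<lambda>s. \<phi> s y) D (orbit \<phi> x))"
  obtain D where "P (x, D)" using fundamental_domain[OF assms] by (auto simp: P_def)
  then have "P (Eps P)" by (rule someI)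
  moreover obtain y D where "Eps P = (y, D)" by (cases "Eps P")
  ultimately show ?thesis
    by (intro that[of y D]) (auto simp: leaf_measure_def P_def case_prod_beta)
qed

lemma sets_leaf_measure:
  assumes "\<not> (\<forall>t. \<phi> t x = x)"
  shows "sets (leaf_measure (orbit \<phi> x)) = sets (restrict_space borel (orbit \<phi> x))"
  by (rule leaf_measure_rep[OF assms]) simp

text \<open>Any base point on the leaf and any injective set of times that reaches all of
  \<open>B\<close> compute the measure of \<open>B\<close>. This allows \<open>E\<close> to be a
  segment, a fundamental domain or the times spent in a plaque. Both the chosen section and
  \<open>E\<close>, cut down to \<open>B\<close>, parametrize \<open>B\<close> injectively, so they
  have the same length.\<close>

lemma emeasure_leaf_measure:
  assumes x: "\<not> (\<forall>t. \<phi> t x = x)" and E: "E \<in> sets borel" "inj_on (\<lambda>s. \<phi> s x) E"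
    and B: "B \<in> sets borel" "B \<subseteq> (\<lambda>s. \<phi> s x) ` E"
  shows "emeasure (leaf_measure (orbit \<phi> x)) B = 1 / 2 * emeasure lborel {s \<in> E. \<phi> s x \<in> B}"
proof -
  note E(1)[measurable] B(1)[measurable]
  obtain y D where y: "orbit \<phi> y = orbit \<phi> x" and D: "D \<in> sets borel" "bij_betw (\<lambda>s. \<phi> s y) D (orbit \<phi> x)"
    and m: "leaf_measure (orbit \<phi> x) =
       scale_measure (1 / 2) (distr (restrict_space lborel D) (restrict_space borel (orbit \<phi> x)) (\<lambda>s. \<phi> s y))"
    using leaf_measure_rep[OF x] .
  note D(1)[measurable]
  obtain c where c: "x = \<phi> c y" using y in_orbit(2)[of x] by (metis orbit_def rangeE)
  have ny: "\<not> (\<forall>t. \<phi> t y = y)"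
  proof
    assume "\<forall>t. \<phi> t y = y"
    moreover from this have "x = y" using c by simp
    ultimately show False using x by simp
  qed
  have BO: "B \<subseteq> orbit \<phi> x" using B(2) by auto
  have f: "(\<lambda>s. \<phi> s y) \<in> restrict_space lborel D \<rightarrow>\<^sub>M restrict_space borel (orbit \<phi> x)"
    by (intro measurable_restrict_space2 measurable_restrict_space1) (auto simp: y[symmetric])
  have "B \<in> sets (restrict_space borel (orbit \<phi> x))"
    using B(1) BO by (auto simp: sets_restrict_space image_iff)
  then have "emeasure (leaf_measure (orbit \<phi> x)) B =
      1 / 2 * emeasure (restrict_space lborel D) ((\<lambda>s. \<phi> s y) -` B \<inter> space (restrict_space lborel D))"
    unfolding m by (simp add: emeasure_distr[OF f])
  also have "(\<lambda>s. \<phi> s y) -` B \<inter> space (restrict_space lborel D) = {s \<in> D. \<phi> s y \<in> B}"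
    by (auto simp: space_restrict_space)
  also have "emeasure (restrict_space lborel D) {s \<in> D. \<phi> s y \<in> B} = emeasure lborel {s \<in> D. \<phi> s y \<in> B}"
    by (rule emeasure_restrict_space) (use D(1) in auto)
  \<comment> \<open>As \<open>x = \<phi> c y\<close>, a time \<open>u\<close> counted from
    \<open>y\<close> is the time \<open>u - c\<close> counted from \<open>x\<close>.\<close>
  also have "\<dots> = emeasure lborel {u. u - c \<in> E \<and> \<phi> u y \<in> B}"
  proof (rule emeasure_lborel_section_eq[OF ny])
    show "inj_on (\<lambda>s. \<phi> s y) {s \<in> D. \<phi> s y \<in> B}"
      using D(2) by (auto simp: bij_betw_def intro: inj_on_subset)
    have shift: "\<phi> u y = \<phi> (u - c) x" for u by (simp add: c flow_flow)
    show "inj_on (\<lambda>s. \<phi> s y) {u. u - c \<in> E \<and> \<phi> u y \<in> B}"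
    proof (rule inj_onI)
      fix u v assume uv: "u \<in> {u. u - c \<in> E \<and> \<phi> u y \<in> B}" "v \<in> {u. u - c \<in> E \<and> \<phi> u y \<in> B}"
        "\<phi> u y = \<phi> v y"
      then have "u - c = v - c" using inj_onD[OF E(2), of "u - c" "v - c"] by (simp add: shift)
      then show "u = v" by simp
    qed
    have "(\<lambda>s. \<phi> s y) ` {s \<in> D. \<phi> s y \<in> B} = B"
      using D(2) BO by (force simp: bij_betw_def)
    moreover have "(\<lambda>s. \<phi> s y) ` {u. u - c \<in> E \<and> \<phi> u y \<in> B} = B"
    proof (intro set_eqI iffI)
      fix b assume b: "b \<in> B"
      then obtain e where "e \<in> E" "b = \<phi> e x" using B(2) by blast
      then show "b \<in> (\<lambda>s. \<phi> s y) ` {u. u - c \<in> E \<and> \<phi> u y \<in> B}"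
        using b by (intro image_eqI[of _ _ "e + c"]) (auto simp: shift)
    qed auto
    ultimately show "(\<lambda>s. \<phi> s y) ` {s \<in> D. \<phi> s y \<in> B} =
      (\<lambda>s. \<phi> s y) ` {u. u - c \<in> E \<and> \<phi> u y \<in> B}" by simp
  qed measurable
  also have "\<dots> = emeasure lborel {s. c + s \<in> {u. u - c \<in> E \<and> \<phi> u y \<in> B}}"
    by (rule emeasure_lborel_translate[symmetric]) measurable
  also have "{s. c + s \<in> {u. u - c \<in> E \<and> \<phi> u y \<in> B}} = {s \<in> E. \<phi> s x \<in> B}"
    by (auto simp: c flow_flow add.commute)
  finally show ?thesis .
qed

lemma orbit_borel: "orbit \<phi> x \<in> sets borel"
proof -
  have "orbit \<phi> x = (\<Union>n::nat. (\<lambda>s. \<phi> s x) ` {- real n..real n})"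
  proof (intro set_eqI iffI)
    fix y assume "y \<in> orbit \<phi> x"
    then obtain t where t: "y = \<phi> t x" by (auto simp: orbit_def)
    obtain n :: nat where "\<bar>t\<bar> \<le> real n" using real_arch_simple by blast
    then have "t \<in> {- real n..real n}" by auto
    then show "y \<in> (\<Union>n::nat. (\<lambda>s. \<phi> s x) ` {- real n..real n})" using t by blast
  qed auto
  also have "\<dots> \<in> sets borel"
    by (intro sets.countable_UN image_subsetI borel_compact compact_continuous_image continuous_intros) auto
  finally show ?thesis .
qed

lemma emeasure_leaf_measure_segment:
  assumes x: "\<not> (\<forall>t. \<phi> t x = x)" and t: "t \<ge> 0" "inj_on (\<lambda>\<tau>. \<phi> \<tau> x) {0..t}"
  shows "emeasure (leaf_measure (orbit \<phi> x)) ((\<lambda>\<tau>. \<phi> \<tau> x) ` {0..t}) = ennreal (t / 2)"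
proof -
  have "(\<lambda>\<tau>. \<phi> \<tau> x) ` {0..t} \<in> sets borel"
    by (intro borel_compact compact_continuous_image continuous_intros) auto
  then have "emeasure (leaf_measure (orbit \<phi> x)) ((\<lambda>\<tau>. \<phi> \<tau> x) ` {0..t}) =
      1 / 2 * emeasure lborel {s \<in> {0..t}. \<phi> s x \<in> (\<lambda>\<tau>. \<phi> \<tau> x) ` {0..t}}"
    by (intro emeasure_leaf_measure x t) auto
  also have "{s \<in> {0..t}. \<phi> s x \<in> (\<lambda>\<tau>. \<phi> \<tau> x) ` {0..t}} = {0..t}" by auto
  also have "1 / 2 * emeasure lborel {0..t} = ennreal (t / 2)"
    using t(1) by (simp add: ennreal_divide_numeral[symmetric] ennreal_times_divide mult.commute)
  finally show ?thesis .
qed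

text \<open>The times at which \<open>x\<close> is in the preimage of \<open>A\<close> are the times
  at which \<open>\<phi> 1 x\<close> is in \<open>A\<close>, and \<open>\<phi> 1 x\<close> is
  another base point of the same leaf.\<close>

lemma invariant_leaf_measure:
  assumes x: "\<not> (\<forall>t. \<phi> t x = x)"
  shows "invariant_measure (\<phi> 1) (leaf_measure (orbit \<phi> x))"
proof -
  define L where "L = orbit \<phi> x"
  define m where "m = leaf_measure L"
  have setsm: "sets m = sets (restrict_space borel L)" unfolding m_def L_def by (rule sets_leaf_measure[OF x])
  then have spm: "space m = L" using sets_eq_imp_space_eq[OF setsm] by (simp add: space_restrict_space)
  have inO: "\<phi> t y \<in> L \<longleftrightarrow> y \<in> L" for t y
    unfolding L_def by (metis in_orbit(2) orbit_eq orbit_flow)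
  have "\<phi> 1 \<in> restrict_space borel L \<rightarrow>\<^sub>M restrict_space borel L"
  proof (intro measurable_restrict_space2 measurable_restrict_space1)
    have "(\<lambda>x. \<phi> 1 x) \<in> borel \<rightarrow>\<^sub>M borel" by measurable
    then show "\<phi> 1 \<in> borel \<rightarrow>\<^sub>M borel" by simp
  qed (auto simp: space_restrict_space inO)
  then have meas: "\<phi> 1 \<in> m \<rightarrow>\<^sub>M m" by (simp cong: measurable_cong_sets add: setsm)
  obtain D where D: "D \<in> sets borel" "bij_betw (\<lambda>s. \<phi> s x) D L"
    using fundamental_domain[OF x] unfolding L_def .
  have "distr m m (\<phi> 1) = m"
  proof (rule measure_eqI)
    fix A assume "A \<in> sets (distr m m (\<phi> 1))"
    then have "A \<in> sets m" by simp
    then have A[measurable]: "A \<in> sets borel" and AO: "A \<subseteq> L"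
      using orbit_borel[of x] unfolding setsm L_def by (auto simp: sets_restrict_space_iff)
    define B where "B = {y \<in> L. \<phi> 1 y \<in> A}"
    have [measurable]: "L \<in> sets borel" unfolding L_def by (rule orbit_borel)
    have Bm: "B \<in> sets borel" unfolding B_def by measurable
    have "emeasure (distr m m (\<phi> 1)) A = emeasure m (\<phi> 1 -` A \<inter> space m)"
      using meas \<open>A \<in> sets m\<close> by (rule emeasure_distr)
    also have "\<phi> 1 -` A \<inter> space m = B" by (auto simp: spm B_def)
    also have "emeasure m B = 1 / 2 * emeasure lborel {s \<in> D. \<phi> s x \<in> B}"
      unfolding m_def L_def
      by (rule emeasure_leaf_measure[OF x D(1) _ Bm]) (use D(2) in \<open>auto simp: bij_betw_def B_def\<close>)
    also have "{s \<in> D. \<phi> s x \<in> B} = {s \<in> D. \<phi> s (\<phi> 1 x) \<in> A}"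
      by (auto simp: B_def flow_flow add.commute inO) (simp add: L_def)
    also have "1 / 2 * emeasure lborel \<dots> = emeasure (leaf_measure (orbit \<phi> (\<phi> 1 x))) A"
    proof (rule emeasure_leaf_measure[symmetric, OF _ D(1) _ A])
      show "\<not> (\<forall>t. \<phi> t (\<phi> 1 x) = \<phi> 1 x)"
      proof
        assume *: "\<forall>t. \<phi> t (\<phi> 1 x) = \<phi> 1 x"
        have "\<phi> (-1) (\<phi> 1 x) = \<phi> 1 x" using * by blast
        then have "\<phi> 1 x = x" by (simp add: flow_flow)
        with * x show False by simp
      qed
      have s: "\<phi> s (\<phi> 1 x) = \<phi> 1 (\<phi> s x)" for s by (simp add: flow_flow add.commute)
      have i: "y = z" if "\<phi> 1 y = \<phi> 1 z" for y z
        using arg_cong[OF that, of "\<phi> (-1)"] by (simp add: flow_flow)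
      show "inj_on (\<lambda>s. \<phi> s (\<phi> 1 x)) D"
        using D(2) i unfolding s by (auto simp: bij_betw_def inj_on_def)
      show "A \<subseteq> (\<lambda>s. \<phi> s (\<phi> 1 x)) ` D"
      proof
        fix a assume "a \<in> A"
        then have "\<phi> (-1) a \<in> L" using AO inO by blast
        then obtain s where "s \<in> D" "\<phi> (-1) a = \<phi> s x" using D(2) by (auto simp: bij_betw_def)
        then have "a = \<phi> 1 (\<phi> s x)" by (metis add.right_inverse flow_flow flow_zero)
        then show "a \<in> (\<lambda>s. \<phi> s (\<phi> 1 x)) ` D" using \<open>s \<in> D\<close> s by auto
      qed
    qed
    also have "\<dots> = emeasure m A" by (simp add: m_def L_def)
    finally show "emeasure (distr m m (\<phi> 1)) A = emeasure m A" .
  qed simp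
  then show ?thesis using meas by (simp add: invariant_measure_def m_def L_def)
qed

end

subsection \<open>Plaques as orbit segments\<close>

lemma emeasure_lborel_open_pos:
  fixes S :: "real set"
  assumes "open S" "c \<in> S"
  shows "emeasure lborel S > 0"
proof -
  obtain e where e: "e > 0" "ball c e \<subseteq> S" using assms by (meson openE)
  have "{c - e<..<c + e} \<subseteq> S" using e(2) by (auto simp: ball_eq_greaterThanLessThan)
  then have "emeasure lborel {c - e<..<c + e} \<le> emeasure lborel S"
    using assms(1) by (intro emeasure_mono) auto
  moreover have "emeasure lborel {c - e<..<c + e} = ennreal (2 * e)"
    using e(1) by simp
  ultimately show ?thesis using e(1) by (metis ennreal_less_zero_iff less_le_trans mult_pos_pos zero_less_numeral)
qed

context cont_flow
begin

lemma flow_int_period: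
  assumes "\<phi> p x = x"
  shows "\<phi> (of_int n * p) x = x"
proof -
  have nat: "\<phi> (real k * q) x = x" if "\<phi> q x = x" for k q
  proof (induction k)
    case (Suc k)
    have "\<phi> (real (Suc k) * q) x = \<phi> (real k * q) (\<phi> q x)" by (simp add: flow_flow algebra_simps)
    then show ?case using Suc that by simp
  qed simp
  have "\<phi> (- p) x = x" using assms stabilizer_eq[of 0 x p] by simp
  then show ?thesis
    using nat[OF assms, of "nat n"] nat[of "- p" "nat (- n)"] by (cases "n \<ge> 0") auto
qed

text \<open>The connected component of 0 in the set of times at which the trajectory of
  \<open>y\<close> is in \<open>U\<close>; it is empty if \<open>y\<close> is not in
  \<open>U\<close>.\<close>

definition stay :: "'a set \<Rightarrow> 'a \<Rightarrow> real set" where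
  "stay U y = {s. \<forall>u\<in>closed_segment 0 s. \<phi> u y \<in> U}"

lemma stay_zero: "0 \<in> stay U y \<longleftrightarrow> y \<in> U"
  by (simp add: stay_def)

lemma stay_in: "s \<in> stay U y \<Longrightarrow> \<phi> s y \<in> U"
  by (auto simp: stay_def)

lemma stay_imp: "s \<in> stay U y \<Longrightarrow> y \<in> U"
  unfolding stay_def using flow_zero[of y] by (metis (no_types, lifting) ends_in_segment(1) mem_Collect_eq)

lemma is_interval_stay: "is_interval (stay U y)"
  unfolding is_interval_1 stay_def closed_segment_eq_real_ivl by auto

lemma stay_flow:
  assumes c: "c \<in> stay U y"
  shows "s \<in> stay U (\<phi> c y) \<longleftrightarrow> s + c \<in> stay U y"
proof
  assume s: "s \<in> stay U (\<phi> c y)"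
  have "\<phi> u y \<in> U" if "u \<in> closed_segment 0 (s + c)" for u
  proof (cases "u \<in> closed_segment 0 c")
    case False
    then have "u - c \<in> closed_segment 0 s"
      using that by (auto simp: closed_segment_eq_real_ivl split: if_splits)
    then have "\<phi> (u - c) (\<phi> c y) \<in> U" using s by (auto simp: stay_def)
    then show ?thesis by (simp add: flow_flow)
  qed (use c in \<open>auto simp: stay_def\<close>)
  then show "s + c \<in> stay U y" by (simp add: stay_def)
next
  assume s: "s + c \<in> stay U y"
  have "\<phi> (u + c) y \<in> U" if "u \<in> closed_segment 0 s" for u
  proof -
    have "u + c \<in> closed_segment 0 c \<or> u + c \<in> closed_segment 0 (s + c)"
      using that by (auto simp: closed_segment_eq_real_ivl split: if_splits)
    then show ?thesis using c s by (auto simp: stay_def)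
  qed
  then show "s \<in> stay U (\<phi> c y)" by (simp add: stay_def flow_flow)
qed

text \<open>Being connected inside \<open>U\<close> along the flow is symmetric. In the mass
  transports this turns the points to which \<open>y\<close> sends into the points from which
  \<open>y\<close> receives.\<close>

lemma stay_minus: "- s \<in> stay U (\<phi> s y) \<longleftrightarrow> s \<in> stay U y"
proof
  assume "s \<in> stay U y"
  then show "- s \<in> stay U (\<phi> s y)" using stay_imp by (simp add: stay_flow stay_zero)
next
  assume *: "- s \<in> stay U (\<phi> s y)"
  then have "s \<in> stay U (\<phi> (- s) (\<phi> s y))" using stay_imp by (simp add: stay_flow stay_zero)
  then show "s \<in> stay U y" by (simp add: flow_flow)
qed

text \<open>After rescaling the segment from 0 to \<open>s\<close> to \<open>[0, 1]\<close>, the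
  condition ranges over one compact set for all pairs, and the tube lemma applies. Openness of the
  set of pairs is the source of all later measurability in \<open>y\<close>.\<close>

lemma open_stay_pairs:
  assumes "open U"
  shows "open {(y, s). s \<in> stay U y}"
proof (subst open_subopen, intro ballI)
  fix p assume p: "p \<in> {(y, s). s \<in> stay U y}"
  define W where "W = (\<lambda>q. \<phi> (snd q * snd (fst q)) (fst (fst q))) -` U"
  have "open W" unfolding W_def
    by (rule open_vimage[OF assms]) (intro continuous_intros)
  have seg: "closed_segment 0 s = (\<lambda>r. r * s) ` {0..1}" for s :: real
    by (auto simp: closed_segment_def)
  have W: "{p} \<times> {0..1} \<subseteq> W \<longleftrightarrow> p \<in> {(y, s). s \<in> stay U y}" for p
    by (cases p) (auto simp: W_def stay_def seg)
  obtain X0 where X0: "p \<in> X0" "open X0" "X0 \<times> {0..1} \<subseteq> W"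
    using Elementary_Topology.tube_lemma[OF compact_Icc \<open>open W\<close>, of p 0 1] W p by blast
  have "X0 \<subseteq> {(y, s). s \<in> stay U y}"
  proof
    fix q assume "q \<in> X0"
    then have "{q} \<times> {0..1} \<subseteq> W" using X0(3) by blast
    then show "q \<in> {(y, s). s \<in> stay U y}" using W by blast
  qed
  then show "\<exists>T. open T \<and> p \<in> T \<and> T \<subseteq> {(y, s). s \<in> stay U y}" using X0 by blast
qed

lemma open_stay: "open U \<Longrightarrow> open (stay U y)"
proof -
  assume "open U"
  then have "open (Pair y -` {(y, s). s \<in> stay U y})"
    by (intro open_vimage open_stay_pairs continuous_intros)
  then show ?thesis by (simp add: vimage_def)
qed

end

section \<open>The plaques of a fixed chart\<close>

locale flow_chart = cont_flow \<phi>
  for \<phi> :: "real \<Rightarrow> 'a::{metric_space, second_countable_topology} \<Rightarrow> 'a" +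
  fixes U T :: "'a set" and I :: "real set" and h :: "'a \<times> real \<Rightarrow> 'a" and g :: "'a \<Rightarrow> 'a \<times> real"
  assumes chart: "foliated_chart \<phi> U T I h g"
begin

abbreviation "base y \<equiv> fst (g y)"
abbreviation "coord y \<equiv> snd (g y)"
abbreviation "dwell y \<equiv> stay U y"

lemma open_U: "open U" and open_I: "open I" and I_ne: "I \<noteq> {}"
  using chart by (auto simp: foliated_chart_def)

lemma g_cont: "continuous_on U g" and h_cont: "continuous_on (T \<times> I) h"
  and gh: "p \<in> T \<times> I \<Longrightarrow> g (h p) = p" and hg: "y \<in> U \<Longrightarrow> h (g y) = y"
  and h_in: "p \<in> T \<times> I \<Longrightarrow> h p \<in> U" and g_in: "y \<in> U \<Longrightarrow> g y \<in> T \<times> I"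
  using chart by (auto simp: foliated_chart_def homeomorphism_def)

lemma base_in: "y \<in> U \<Longrightarrow> base y \<in> T" and coord_in: "y \<in> U \<Longrightarrow> coord y \<in> I"
  using g_in by (auto simp: mem_Times_iff)

lemma in_plaque_iff: "z \<in> T \<Longrightarrow> y \<in> plaque h I z \<longleftrightarrow> y \<in> U \<and> base y = z"
proof
  assume "z \<in> T" "y \<in> plaque h I z"
  then obtain i where "i \<in> I" "y = h (z, i)" by (auto simp: plaque_def)
  then show "y \<in> U \<and> base y = z" using \<open>z \<in> T\<close> h_in[of "(z, i)"] gh[of "(z, i)"] by auto
next
  assume "z \<in> T" "y \<in> U \<and> base y = z"
  then show "y \<in> plaque h I z"
    unfolding plaque_def using hg[of y] coord_in[of y] by (metis SigmaI image_eqI prod.collapse singletonI)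
qed

lemma plaque_borel: "z \<in> T \<Longrightarrow> plaque h I z \<in> sets borel"
proof -
  assume z: "z \<in> T"
  have "closedin (top_of_set U) {y \<in> U. base y = z}"
    by (rule continuous_closedin_preimage_constant) (intro continuous_intros g_cont)
  then obtain C where "closed C" "{y \<in> U. base y = z} = U \<inter> C" by (auto simp: closedin_closed)
  moreover have "plaque h I z = {y \<in> U. base y = z}" using in_plaque_iff[OF z] by blast
  ultimately show ?thesis using open_U by auto
qed

text \<open>If the coordinate took a value twice, at times \<open>s < t\<close>, the orbit would
  have period \<open>t - s\<close>, and \<open>I\<close> would be the image of the compact interval
  \<open>[s, t]\<close>. But \<open>I\<close> is open and nonempty in the line, hence not
  compact.\<close>

lemma plaque_parametrization:
  assumes z: "z \<in> T" and J: "is_interval J" and P: "plaque h I z = (\<lambda>t. \<phi> t x) ` J"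
  defines "f \<equiv> \<lambda>s. coord (\<phi> s x)"
  shows "continuous_on J f" "f ` J = I" "inj_on f J"
proof -
  have on_P: "\<phi> s x \<in> U" "base (\<phi> s x) = z" if "s \<in> J" for s
    using in_plaque_iff[OF z, of "\<phi> s x"] P that by auto
  have hf: "h (z, f s) = \<phi> s x" if "s \<in> J" for s
    using on_P[OF that] hg[of "\<phi> s x"] by (metis f_def prod.collapse)
  show cont: "continuous_on J f"
    unfolding f_def
    by (intro continuous_intros continuous_on_compose2[OF g_cont]) (use on_P in auto)
  show fJ: "f ` J = I"
  proof (intro set_eqI iffI)
    fix i assume i: "i \<in> I"
    then have "h (z, i) \<in> (\<lambda>t. \<phi> t x) ` J" using P by (auto simp: plaque_def)
    then obtain s where s: "s \<in> J" "h (z, i) = \<phi> s x" by blast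
    then have "f s = i" using gh[of "(z, i)"] z i by (simp add: f_def flip: s(2))
    then show "i \<in> f ` J" using s(1) by blast
  qed (use on_P coord_in in \<open>auto simp: f_def\<close>)
  have False if st: "s \<in> J" "t \<in> J" "s < t" "f s = f t" for s t
  proof -
    define p where "p = t - s"
    have p0: "p > 0" using st by (simp add: p_def)
    have "\<phi> t x = \<phi> s x" using hf[OF st(1)] hf[OF st(2)] st(4) by simp
    then have per: "\<phi> p x = x" by (simp add: p_def stabilizer_eq)
    have sub: "{s..t} \<subseteq> J" using mem_is_interval_1_I[OF J st(1,2)] by auto
    have "I = f ` {s..t}"
    proof (intro subset_antisym subsetI)
      fix i assume "i \<in> I"
      then obtain u where u: "u \<in> J" "i = f u" using fJ by blast
      define v where "v = u - of_int \<lfloor>(u - s) / p\<rfloor> * p"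
      have "\<phi> v x = \<phi> u x"
        unfolding v_def using flow_int_period[OF per, of "- \<lfloor>(u - s) / p\<rfloor>"] by (subst stabilizer_eq) simp
      then have "f v = i" using u by (simp add: f_def)
      moreover have "v \<in> {s..t}"
        using floor_divide_lower[OF p0, of "u - s"] floor_divide_upper[OF p0, of "u - s"]
        by (auto simp: v_def p_def algebra_simps)
      ultimately show "i \<in> f ` {s..t}" by blast
    qed (use sub fJ in blast)
    then have "compact I"
      using compact_continuous_image[OF continuous_on_subset[OF cont sub] compact_Icc] by simp
    then have "I = UNIV" using clopen[of I] open_I I_ne compact_imp_closed by blast
    then show False using \<open>compact I\<close> compact_imp_bounded not_bounded_UNIV by blast
  qed
  then show "inj_on f J" by (metis (no_types, lifting) inj_onI linorder_less_linear)
qed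

text \<open>A continuous injection on an interval is strictly monotone. It may run against the flow,
  hence the minimum and maximum of the two times in the proof.\<close>

lemma plaque_parametrization_between:
  assumes z: "z \<in> T" and J: "is_interval J" and P: "plaque h I z = (\<lambda>t. \<phi> t x) ` J"
    and ab: "a \<in> I" "b \<in> I"
  obtains s t where "s \<in> J" "t \<in> J" "s \<le> t"
    "\<And>u. u \<in> J \<Longrightarrow> a < coord (\<phi> u x) \<Longrightarrow> coord (\<phi> u x) < b \<Longrightarrow> s < u \<and> u < t"
proof -
  define f where "f = (\<lambda>s. coord (\<phi> s x))"
  have cont: "continuous_on J f" and fJ: "f ` J = I" and inj: "inj_on f J"
    unfolding f_def by (fact plaque_parametrization[OF z J P])+
  obtain s where s: "s \<in> J" "f s = a" using fJ ab by blast
  obtain t where t: "t \<in> J" "f t = b" using fJ ab by blast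
  consider "strict_mono_on J f" | "strict_antimono_on J f"
    using inj injective_eq_monotone_map[OF J cont] by blast
  then have btw: "(s < u \<and> u < t) \<or> (t < u \<and> u < s)" if "u \<in> J" "a < f u" "f u < b" for u
  proof cases
    case 1
    then show ?thesis using that s t by (auto simp: strict_mono_on_less)
  next
    case 2
    have "s \<noteq> u" "t \<noteq> u" using that s t by auto
    moreover have "\<not> s < u" using monotone_onD[OF 2 s(1) that(1)] that s by fastforce
    moreover have "\<not> u < t" using monotone_onD[OF 2 that(1) t(1)] that t by fastforce
    ultimately show ?thesis by auto
  qed
  show ?thesis
  proof (rule that[of "min s t" "max s t"])
    show "min s t \<in> J" "max s t \<in> J" "min s t \<le> max s t" using s(1) t(1) by (auto simp: min_def max_def)
    fix u assume "u \<in> J" "a < coord (\<phi> u x)" "coord (\<phi> u x) < b"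
    then show "min s t < u \<and> u < max s t" using btw[of u] unfolding f_def by linarith
  qed
qed

text \<open>The chart only provides some interval \<open>J\<close> of times, possibly with end
  points. As \<open>I\<close> is open, coordinates on both sides of that of \<open>x\<close> are
  attained, at times on both sides of 0.\<close>

lemma plaque_interior:
  assumes z: "z \<in> T" and J: "is_interval J" and P: "plaque h I z = (\<lambda>t. \<phi> t x) ` J" and "0 \<in> J"
  obtains e where "e > 0" "{- e<..<e} \<subseteq> J"
proof -
  have "\<phi> 0 x \<in> plaque h I z" using P \<open>0 \<in> J\<close> by blast
  then have "x \<in> U" using in_plaque_iff[OF z] by simp
  then obtain d where d: "d > 0" "ball (coord x) d \<subseteq> I" using open_I coord_in by (meson openE)
  then have "coord x - d / 2 \<in> I" "coord x + d / 2 \<in> I" by (auto simp: dist_real_def intro!: subsetD[OF d(2)])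
  then obtain s t where st: "s \<in> J" "t \<in> J" "s < 0" "0 < t"
    using plaque_parametrization_between[OF z J P, of "coord x - d / 2" "coord x + d / 2"] \<open>0 \<in> J\<close> d(1)
    by (metis (no_types, lifting) diff_less_eq flow_zero half_gt_zero less_add_same_cancel1)
  show ?thesis
  proof
    show "min (- s) t > 0" using st by simp
    show "{- min (- s) t<..<min (- s) t} \<subseteq> J"
      using mem_is_interval_1_I[OF J st(1,2)] by auto
  qed
qed

lemma local_plaque:
  assumes y: "y \<in> U"
  obtains J where "is_interval J" "0 \<in> J" "plaque h I (base y) = (\<lambda>t. \<phi> t y) ` J"
proof -
  obtain x J where J: "is_interval J" "plaque h I (base y) = (\<lambda>t. \<phi> t x) ` J"
    using chart base_in[OF y] unfolding foliated_chart_def by blast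
  have "y \<in> plaque h I (base y)" using in_plaque_iff[OF base_in[OF y]] y by blast
  then obtain c where c: "c \<in> J" "y = \<phi> c x" using J(2) by blast
  show ?thesis
  proof
    show "is_interval {s. s + c \<in> J}" using J(1) unfolding is_interval_1
      by (metis (no_types, lifting) add_right_mono mem_Collect_eq)
    show "0 \<in> {s. s + c \<in> J}" using c by simp
    have "(\<lambda>t. \<phi> t x) ` J = (\<lambda>t. \<phi> t y) ` {s. s + c \<in> J}"
    proof (intro set_eqI iffI)
      fix w assume "w \<in> (\<lambda>t. \<phi> t x) ` J"
      then obtain t where "t \<in> J" "w = \<phi> t x" by blast
      then show "w \<in> (\<lambda>t. \<phi> t y) ` {s. s + c \<in> J}"
        by (intro image_eqI[of _ _ "t - c"]) (auto simp: c flow_flow)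
    qed (auto simp: c flow_flow)
    then show "plaque h I (base y) = (\<lambda>t. \<phi> t y) ` {s. s + c \<in> J}" using J(2) by simp
  qed
qed

text \<open>By \<open>plaque_interior\<close> the base point is locally constant along the
  trajectory while it stays in \<open>U\<close>, hence constant on the connected segment of
  times.\<close>

lemma base_dwell:
  assumes s: "s \<in> dwell y"
  shows "base (\<phi> s y) = base y"
proof -
  define S where "S = closed_segment 0 s"
  have inU: "\<phi> u y \<in> U" if "u \<in> S" for u using s that by (auto simp: stay_def S_def)
  have "base (\<phi> 0 y) = base (\<phi> s y)"
  proof (rule connected_equivalence_relation[of S 0 s "\<lambda>u v. base (\<phi> u y) = base (\<phi> v y)"])
    show "connected S" "0 \<in> S" "s \<in> S" by (auto simp: S_def)
    fix u assume u: "u \<in> S"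
    obtain J where J: "is_interval J" "0 \<in> J" "plaque h I (base (\<phi> u y)) = (\<lambda>t. \<phi> t (\<phi> u y)) ` J"
      using local_plaque[OF inU[OF u]] .
    obtain e where e: "e > 0" "{- e<..<e} \<subseteq> J"
      using plaque_interior[OF base_in[OF inU[OF u]] J(1) J(3) J(2)] .
    have "base (\<phi> u y) = base (\<phi> v y)" if "v \<in> {u - e<..<u + e}" for v
    proof -
      have "v - u \<in> J" using that e(2) by auto
      then have "\<phi> (v - u) (\<phi> u y) \<in> plaque h I (base (\<phi> u y))" using J(3) by blast
      then show ?thesis using in_plaque_iff[OF base_in[OF inU[OF u]]] by (simp add: flow_flow)
    qed
    then show "\<exists>T. openin (top_of_set S) T \<and> u \<in> T \<and> (\<forall>v\<in>T. base (\<phi> u y) = base (\<phi> v y))"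
      using u e(1) by (intro exI[of _ "S \<inter> {u - e<..<u + e}"]) (auto intro: openin_open_Int)
  qed auto
  then show ?thesis by simp
qed

text \<open>Describes the plaque of \<open>y\<close> by the flow and \<open>U\<close> alone, in a
  form that depends measurably on \<open>y\<close>. An interval of times containing 0 whose points
  are in \<open>U\<close> lies in \<open>dwell y\<close>; conversely, staying in \<open>U\<close>
  keeps the base point.\<close>

lemma plaque_eq_dwell:
  assumes y: "y \<in> U"
  shows "plaque h I (base y) = (\<lambda>t. \<phi> t y) ` dwell y"
proof (intro subset_antisym subsetI)
  fix w assume "w \<in> plaque h I (base y)"
  moreover obtain J where J: "is_interval J" "0 \<in> J" "plaque h I (base y) = (\<lambda>t. \<phi> t y) ` J"
    using local_plaque[OF y] .
  ultimately obtain t where t: "t \<in> J" "w = \<phi> t y" by blast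
  have "\<phi> u y \<in> U" if "u \<in> closed_segment 0 t" for u
  proof -
    have "u \<in> J"
      using that mem_is_interval_1_I[OF J(1) J(2) t(1)] mem_is_interval_1_I[OF J(1) t(1) J(2)]
      by (auto simp: closed_segment_eq_real_ivl split: if_splits)
    then have "\<phi> u y \<in> plaque h I (base y)" using J(3) by blast
    then show ?thesis using in_plaque_iff[OF base_in[OF y]] by blast
  qed
  then show "w \<in> (\<lambda>t. \<phi> t y) ` dwell y" using t by (auto simp: stay_def)
next
  fix w assume "w \<in> (\<lambda>t. \<phi> t y) ` dwell y"
  then show "w \<in> plaque h I (base y)"
    using in_plaque_iff[OF base_in[OF y]] base_dwell stay_in by blast
qed

lemmas dwell_parametrization =
  plaque_parametrization[OF base_in is_interval_stay plaque_eq_dwell]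

lemma inj_on_dwell:
  assumes "y \<in> U"
  shows "inj_on (\<lambda>s. \<phi> s y) (dwell y)"
  using dwell_parametrization(3)[OF assms assms] unfolding inj_on_def by metis

lemma not_fixed:
  assumes "y \<in> U"
  shows "\<not> (\<forall>t. \<phi> t y = y)"
proof
  assume fixed: "\<forall>t. \<phi> t y = y"
  have "open (dwell y)" "0 \<in> dwell y" using open_stay[OF open_U] assms by (simp_all add: stay_zero)
  then obtain e where e: "e > 0" "ball 0 e \<subseteq> dwell y" by (meson openE)
  then have "e / 2 \<in> dwell y" by (auto simp: dist_real_def intro!: subsetD[OF e(2)])
  then have "e / 2 = 0" using inj_onD[OF inj_on_dwell[OF assms], of "e / 2" 0] \<open>0 \<in> dwell y\<close> fixed by simp
  then show False using e by simp
qed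

text \<open>Even a plaque of infinite duration crosses a slab between two coordinate levels in
  finite time, because strict monotonicity confines the crossing to a bounded interval.\<close>

lemma dwell_coord_bounded:
  assumes y: "y \<in> U" and ab: "a \<in> I" "b \<in> I"
  shows "emeasure lborel {s \<in> dwell y. a < coord (\<phi> s y) \<and> coord (\<phi> s y) < b} < \<infinity>"
proof -
  obtain s t where st: "s \<le> t" "\<And>u. u \<in> dwell y \<Longrightarrow> a < coord (\<phi> u y) \<Longrightarrow> coord (\<phi> u y) < b \<Longrightarrow> s < u \<and> u < t"
    using plaque_parametrization_between[OF base_in[OF y] is_interval_stay plaque_eq_dwell[OF y] ab] by metis
  have "emeasure lborel {s \<in> dwell y. a < coord (\<phi> s y) \<and> coord (\<phi> s y) < b} \<le> emeasure lborel {s..t}"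
    by (rule emeasure_mono) (use st(2) in force)+
  also have "\<dots> < \<infinity>" using st(1) by simp
  finally show ?thesis .
qed

end

subsection \<open>Disintegration along the plaques\<close>

context cont_flow
begin

definition stay_length :: "'a set \<Rightarrow> 'a \<Rightarrow> ennreal" where
  "stay_length U y = emeasure lborel (stay U y)"

lemma stay_pairs_borel [measurable]:
  "open U \<Longrightarrow> Measurable.pred (borel \<Otimes>\<^sub>M borel) (\<lambda>p. snd p \<in> stay U (fst p))"
  using borel_open[OF open_stay_pairs] by (simp add: borel_prod pred_def case_prod_beta')

lemma measurable_stay_section:
  assumes "open U" and P: "Measurable.pred (borel \<Otimes>\<^sub>M borel) (\<lambda>p. P (fst p) (snd p))"
  shows "(\<lambda>y. emeasure lborel {s \<in> stay U y. P y s}) \<in> borel_measurable borel"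
proof -
  note stay_pairs_borel[OF assms(1), measurable] P[measurable]
  have "Measurable.pred (borel \<Otimes>\<^sub>M borel) (\<lambda>p. snd p \<in> stay U (fst p) \<and> P (fst p) (snd p))"
    by measurable
  then have "{p. snd p \<in> stay U (fst p) \<and> P (fst p) (snd p)} \<in> sets (borel \<Otimes>\<^sub>M lborel)"
    by (simp add: sets_pair_measure_cong[OF refl sets_lborel] pred_def space_pair_measure)
  from lborel.measurable_emeasure_Pair[OF this] show ?thesis by (simp add: vimage_def)
qed

lemma measurable_stay_length: "open U \<Longrightarrow> stay_length U \<in> borel_measurable borel"
  using measurable_stay_section[of U "\<lambda>_ _. True"] by (simp add: stay_length_def[abs_def])

lemma emeasure_stay_flow:
  assumes "open U" "c \<in> stay U y" "B \<in> sets borel"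
  shows "emeasure lborel {s \<in> stay U (\<phi> c y). \<phi> s (\<phi> c y) \<in> B} = emeasure lborel {s \<in> stay U y. \<phi> s y \<in> B}"
proof -
  have [measurable]: "stay U y \<in> sets borel" using open_stay[OF assms(1)] by simp
  note assms(3)[measurable]
  have "emeasure lborel {s. c + s \<in> {s \<in> stay U y. \<phi> s y \<in> B}} = emeasure lborel {s \<in> stay U y. \<phi> s y \<in> B}"
    by (rule emeasure_lborel_translate) measurable
  moreover have "{s. c + s \<in> {s \<in> stay U y. \<phi> s y \<in> B}} = {s \<in> stay U (\<phi> c y). \<phi> s (\<phi> c y) \<in> B}"
    using stay_flow[OF assms(2)] by (auto simp: flow_flow add.commute)
  ultimately show ?thesis by simp
qed

lemma stay_length_flow: "open U \<Longrightarrow> c \<in> stay U y \<Longrightarrow> stay_length U (\<phi> c y) = stay_length U y"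
  using emeasure_stay_flow[of U c y UNIV] by (simp add: stay_length_def)

lemma stay_length_pos: "open U \<Longrightarrow> y \<in> U \<Longrightarrow> stay_length U y > 0"
  unfolding stay_length_def using emeasure_lborel_open_pos[OF open_stay] stay_zero by blast

end

section \<open>Mass transport along the flow\<close>

locale invariant_flow = cont_flow \<phi> + prob_space \<mu>
  for \<phi> :: "real \<Rightarrow> 'a::{metric_space, second_countable_topology} \<Rightarrow> 'a" and \<mu> :: "'a measure" +
  assumes sets_mu [measurable_cong]: "sets \<mu> = sets borel"
    and inv: "distr \<mu> \<mu> (\<phi> t) = \<mu>"
begin

lemma space_mu [simp]: "space \<mu> = UNIV"
  using sets_eq_imp_space_eq[OF sets_mu] by simp

text \<open>\<open>F y s\<close> is the density of the mass that \<open>y\<close> sends to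
  \<open>\<phi> s y\<close>. On the right it is counted at the receiver: what arrives at
  \<open>y\<close> after time \<open>s\<close> comes from \<open>\<phi> (- s) y\<close>.\<close>

lemma mass_transport:
  assumes F: "(\<lambda>(y, s). F y s) \<in> borel_measurable (borel \<Otimes>\<^sub>M borel)"
  shows "(\<integral>\<^sup>+y. \<integral>\<^sup>+s. F y s \<partial>lborel \<partial>\<mu>) = (\<integral>\<^sup>+y. \<integral>\<^sup>+s. F (\<phi> (- s) y) s \<partial>lborel \<partial>\<mu>)"
proof -
  interpret pair_sigma_finite \<mu> lborel ..
  have m: "case_prod F \<in> borel_measurable (\<mu> \<Otimes>\<^sub>M lborel)"
    using F by (simp add: measurable_cong_sets[OF sets_pair_measure_cong[OF sets_mu sets_lborel] refl])
  have "(\<lambda>(y, s). F (\<phi> (- s) y) s) = (\<lambda>p. (\<lambda>(y, s). F y s) (\<phi> (- snd p) (fst p), snd p))"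
    by auto
  moreover have "(\<lambda>p. (\<lambda>(y, s). F y s) (\<phi> (- snd p) (fst p), snd p)) \<in> borel_measurable (borel \<Otimes>\<^sub>M borel)"
    by (rule measurable_compose[OF _ F]) measurable
  ultimately have m': "(\<lambda>(y, s). F (\<phi> (- s) y) s) \<in> borel_measurable (\<mu> \<Otimes>\<^sub>M lborel)"
    by (simp add: measurable_cong_sets[OF sets_pair_measure_cong[OF sets_mu sets_lborel] refl])
  have "(\<integral>\<^sup>+y. \<integral>\<^sup>+s. F y s \<partial>lborel \<partial>\<mu>) = (\<integral>\<^sup>+s. \<integral>\<^sup>+y. F y s \<partial>\<mu> \<partial>lborel)"
    using Fubini'[OF m] by simp
  also have "\<dots> = (\<integral>\<^sup>+s. \<integral>\<^sup>+y. F (\<phi> (- s) y) s \<partial>\<mu> \<partial>lborel)"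
  proof (rule nn_integral_cong)
    fix s :: real
    have Fs: "(\<lambda>y. F y s) \<in> borel_measurable \<mu>"
      using measurable_compose[OF measurable_Pair2' m, of s] by simp
    have "(\<lambda>x. \<phi> (- s) x) \<in> borel \<rightarrow>\<^sub>M borel" by measurable
    then have f: "\<phi> (- s) \<in> \<mu> \<rightarrow>\<^sub>M \<mu>" by (simp add: measurable_cong_sets[OF sets_mu sets_mu])
    show "(\<integral>\<^sup>+y. F y s \<partial>\<mu>) = (\<integral>\<^sup>+y. F (\<phi> (- s) y) s \<partial>\<mu>)"
      using nn_integral_distr[OF f, of "\<lambda>y. F y s"] Fs by (simp add: inv)
  qed
  also have "\<dots> = (\<integral>\<^sup>+y. \<integral>\<^sup>+s. F (\<phi> (- s) y) s \<partial>lborel \<partial>\<mu>)"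
    using Fubini'[OF m'] by simp
  finally show ?thesis .
qed

end

locale invariant_chart = flow_chart \<phi> U T I h g + invariant_flow \<phi> \<mu>
  for \<phi> :: "real \<Rightarrow> 'a::{metric_space, second_countable_topology} \<Rightarrow> 'a"
    and U T I h g and \<mu> :: "'a measure"
begin

abbreviation "len y \<equiv> stay_length U y"

lemmas len_flow = stay_length_flow[OF open_U] and len_pos = stay_length_pos[OF open_U]
  and len_measurable [measurable] = measurable_stay_length[OF open_U]
  and dwell_pairs [measurable] = stay_pairs_borel[OF open_U]

lemma U_borel [measurable]: "U \<in> sets borel"
  using open_U by simp

lemma dwell_borel [measurable]: "dwell y \<in> sets borel"
  using open_stay[OF open_U] by simp

lemma emeasure_reflected_dwell:
  assumes B: "B \<in> sets borel"
  shows "emeasure lborel {s. - s \<in> dwell y \<and> \<phi> (- s) y \<in> B} = emeasure lborel {s \<in> dwell y. \<phi> s y \<in> B}"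
proof -
  note B[measurable]
  have "emeasure lborel {s. - s \<in> {s \<in> dwell y. \<phi> s y \<in> B}} = emeasure lborel {s \<in> dwell y. \<phi> s y \<in> B}"
    by (rule emeasure_lborel_reflect) measurable
  then show ?thesis by simp
qed

text \<open>A point of an infinite plaque sends mass \<open>1 / \<ell>\<close> to each unit of time of its plaque, where
  \<open>\<ell> < \<infinity>\<close> is the time the plaque spends in the slab \<open>V\<close>: the points of \<open>V\<close> send out infinite mass,
  while no point receives more than \<open>1\<close>.\<close>

lemma AE_slab_finite:
  assumes ab: "a \<in> I" "b \<in> I"
  shows "AE y in \<mu>. y \<in> U \<longrightarrow> a < coord y \<longrightarrow> coord y < b \<longrightarrow> len y \<noteq> \<infinity>"
proof -
  define V where "V = {y \<in> U. a < coord y \<and> coord y < b}"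
  define N where "N = {y. len y = \<infinity>}"
  define \<l> where "\<l> y = emeasure lborel {s \<in> dwell y. \<phi> s y \<in> V}" for y
  have "V = U \<inter> g -` (UNIV \<times> {a<..<b})" by (auto simp: V_def mem_Times_iff)
  then have "open V"
    using continuous_open_preimage[OF g_cont open_U open_Times[OF open_UNIV open_greaterThanLessThan]] by simp
  then have [measurable]: "V \<in> sets borel" by simp
  have [measurable]: "N \<in> sets borel" unfolding N_def by measurable
  have [measurable]: "\<l> \<in> borel_measurable borel"
    unfolding \<l>_def[abs_def] by (rule measurable_stay_section[OF open_U]) measurable
  have fin: "\<l> y \<noteq> \<infinity>" if "y \<in> U" for y
  proof -
    have "{s \<in> dwell y. \<phi> s y \<in> V} = {s \<in> dwell y. a < coord (\<phi> s y) \<and> coord (\<phi> s y) < b}"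
      using stay_in by (auto simp: V_def)
    then show ?thesis using dwell_coord_bounded[OF that ab] by (simp add: \<l>_def)
  qed
  have \<l>_flow: "\<l> (\<phi> c y) = \<l> y" if "c \<in> dwell y" for c y
    unfolding \<l>_def by (rule emeasure_stay_flow[OF open_U that]) measurable
  define F :: "'a \<Rightarrow> real \<Rightarrow> ennreal" where
    "F y s = indicator (N \<inter> V) y / \<l> y * indicator (dwell y) s" for y s
  have Fm: "(\<lambda>(y, s). F y s) \<in> borel_measurable (borel \<Otimes>\<^sub>M borel)"
    unfolding F_def case_prod_beta' by measurable
  have "(\<integral>\<^sup>+y. \<integral>\<^sup>+s. F y s \<partial>lborel \<partial>\<mu>) = (\<integral>\<^sup>+y. \<infinity> * indicator (N \<inter> V) y \<partial>\<mu>)"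
  proof (rule nn_integral_cong)
    fix y
    have "(\<integral>\<^sup>+s. F y s \<partial>lborel) = indicator (N \<inter> V) y / \<l> y * len y"
      unfolding F_def by (subst nn_integral_cmult_indicator) (simp_all add: stay_length_def)
    also have "\<dots> = \<infinity> * indicator (N \<inter> V) y"
    proof (cases "y \<in> N \<inter> V")
      case True
      \<comment> \<open>\<open>1 / \<l> y\<close> is nonzero because \<open>\<l> y\<close> is
        finite, so its product with the infinite duration is infinite.\<close>
      then have "\<l> y \<noteq> \<infinity>" "len y = \<infinity>" using fin by (auto simp: N_def V_def)
      then show ?thesis using True by (simp add: ennreal_mult_top ennreal_divide_eq_0_iff)
    qed simp
    finally show "(\<integral>\<^sup>+s. F y s \<partial>lborel) = \<infinity> * indicator (N \<inter> V) y" .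
  qed
  also have "\<dots> = \<infinity> * emeasure \<mu> (N \<inter> V)"
    by (rule nn_integral_cmult_indicator) (simp add: sets_mu)
  finally have out: "(\<integral>\<^sup>+y. \<integral>\<^sup>+s. F y s \<partial>lborel \<partial>\<mu>) = \<infinity> * emeasure \<mu> (N \<inter> V)" .
  have "(\<integral>\<^sup>+y. \<integral>\<^sup>+s. F (\<phi> (- s) y) s \<partial>lborel \<partial>\<mu>) \<le> (\<integral>\<^sup>+y. 1 \<partial>\<mu>)"
  proof (rule nn_integral_mono)
    fix y
    \<comment> \<open>Sender and receiver lie on the same plaque and share \<open>\<l>\<close>.
      Hence \<open>y\<close> receives at most \<open>1 / \<l> y\<close> per unit of time, and only
      from the part of its plaque in \<open>V\<close>, which lasts \<open>\<l> y\<close>.\<close>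
    have "F (\<phi> (- s) y) s \<le> 1 / \<l> y * indicator {s. - s \<in> dwell y \<and> \<phi> (- s) y \<in> V} s" for s
    proof (cases "- s \<in> dwell y")
      case True
      then show ?thesis by (auto simp: F_def \<l>_flow split: split_indicator)
    next
      case False
      then have "s \<notin> dwell (\<phi> (- s) y)" using stay_minus[of "- s" U y] by simp
      then show ?thesis by (simp add: F_def)
    qed
    then have "(\<integral>\<^sup>+s. F (\<phi> (- s) y) s \<partial>lborel) \<le>
        (\<integral>\<^sup>+s. 1 / \<l> y * indicator {s. - s \<in> dwell y \<and> \<phi> (- s) y \<in> V} s \<partial>lborel)"
      by (intro nn_integral_mono)
    also have "\<dots> = 1 / \<l> y * \<l> y"
      by (subst nn_integral_cmult_indicator) (simp_all add: emeasure_reflected_dwell \<l>_def)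
    \<comment> \<open>For \<open>\<l> y\<close> equal to 0 or infinity, the product is 0 by the
      conventions of \<open>ennreal\<close>.\<close>
    also have "\<dots> \<le> 1"
      by (cases "\<l> y = 0 \<or> \<l> y = \<infinity>") (auto simp: ennreal_divide_times ennreal_divide_self less_top)
    finally show "(\<integral>\<^sup>+s. F (\<phi> (- s) y) s \<partial>lborel) \<le> 1" .
  qed
  then have "\<infinity> * emeasure \<mu> (N \<inter> V) \<le> 1"
    using out mass_transport[OF Fm] by (simp add: emeasure_space_1[unfolded space_mu])
  then have "emeasure \<mu> (N \<inter> V) = 0" by (auto simp: ennreal_top_mult top_unique split: if_splits)
  then have "AE y in \<mu>. y \<notin> N \<inter> V" by (intro AE_not_in) (simp add: null_sets_def sets_mu)
  then show ?thesis by eventually_elim (auto simp: N_def V_def)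
qed

text \<open>The countably many slabs with rational levels in \<open>I\<close> cover
  \<open>U\<close>.\<close>

lemma AE_len_finite: "AE y in \<mu>. y \<in> U \<longrightarrow> len y \<noteq> \<infinity>"
proof -
  have "AE y in \<mu>. \<forall>a b :: rat. of_rat a \<in> I \<longrightarrow> of_rat b \<in> I \<longrightarrow>
      y \<in> U \<longrightarrow> of_rat a < coord y \<longrightarrow> coord y < of_rat b \<longrightarrow> len y \<noteq> \<infinity>"
    unfolding AE_all_countable
  proof (intro allI)
    fix a b :: rat
    show "AE y in \<mu>. of_rat a \<in> I \<longrightarrow> of_rat b \<in> I \<longrightarrow>
      y \<in> U \<longrightarrow> of_rat a < coord y \<longrightarrow> coord y < of_rat b \<longrightarrow> len y \<noteq> \<infinity>"
      using AE_slab_finite[of "of_rat a" "of_rat b"]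
      by (cases "of_rat a \<in> I \<and> of_rat b \<in> I") auto
  qed
  then show ?thesis
  proof eventually_elim
    case (elim y)
    show ?case
    proof
      assume y: "y \<in> U"
      obtain d where d: "d > 0" "ball (coord y) d \<subseteq> I" using open_I coord_in[OF y] by (meson openE)
      obtain a :: rat where a: "coord y - d < of_rat a" "of_rat a < coord y"
        using of_rat_dense[of "coord y - d" "coord y"] d(1) by auto
      obtain b :: rat where b: "coord y < of_rat b" "of_rat b < coord y + d"
        using of_rat_dense[of "coord y" "coord y + d"] d(1) by auto
      have "of_rat a \<in> I" "of_rat b \<in> I"
        using a b by (auto simp: dist_real_def intro!: subsetD[OF d(2)])
      then show "len y \<noteq> \<infinity>" using elim y a(2) b(1) by blast
    qed
  qed
qed

text \<open>The first case only serves to make \<open>cond\<close> probability-valued on all of \<open>U\<close>.\<close>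

definition cond :: "'a \<Rightarrow> 'a measure" where
  "cond y = (if len y = \<infinity> then return borel y
     else distr (uniform_measure lborel (dwell y)) borel (\<lambda>s. \<phi> s y))"

lemma sets_cond [simp]: "sets (cond y) = sets borel"
  by (simp add: cond_def)

lemma emeasure_cond:
  assumes "len y \<noteq> \<infinity>" and B: "B \<in> sets borel"
  shows "emeasure (cond y) B = emeasure lborel {s \<in> dwell y. \<phi> s y \<in> B} / len y"
proof -
  note B[measurable]
  have "emeasure (cond y) B = emeasure (uniform_measure lborel (dwell y)) {s. \<phi> s y \<in> B}"
    using assms by (simp add: cond_def emeasure_distr vimage_def)
  also have "\<dots> = emeasure lborel (dwell y \<inter> {s. \<phi> s y \<in> B}) / len y"
    by (subst emeasure_uniform_measure) (simp_all add: stay_length_def)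
  finally show ?thesis by (simp add: Int_def)
qed

lemma prob_space_cond:
  assumes y: "y \<in> U"
  shows "prob_space (cond y)"
proof (cases "len y = \<infinity>")
  case False
  have "prob_space (uniform_measure lborel (dwell y))"
    using False len_pos[OF y] by (intro prob_space_uniform_measure) (auto simp: stay_length_def)
  then show ?thesis using False by (auto simp: cond_def intro!: prob_space.prob_space_distr)
qed (simp add: cond_def prob_space_return)

lemma cond_measurable: "cond \<in> restrict_space borel U \<rightarrow>\<^sub>M prob_algebra borel"
proof (intro measurable_prob_algebraI measurable_subprob_algebra)
  fix B :: "'a set" assume B[measurable]: "B \<in> sets borel"
  have [measurable]: "(\<lambda>y. emeasure lborel {s \<in> dwell y. \<phi> s y \<in> B}) \<in> borel_measurable borel"
    by (rule measurable_stay_section[OF open_U]) measurable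
  have "(\<lambda>y. if len y = \<infinity> then indicator B y
      else emeasure lborel {s \<in> dwell y. \<phi> s y \<in> B} / len y) \<in> borel_measurable borel"
    by measurable
  moreover have "emeasure (cond y) B = (if len y = \<infinity> then indicator B y
      else emeasure lborel {s \<in> dwell y. \<phi> s y \<in> B} / len y)" for y
    using emeasure_cond[OF _ B] by (simp add: cond_def)
  ultimately show "(\<lambda>y. emeasure (cond y) B) \<in> borel_measurable (restrict_space borel U)"
    by (simp add: measurable_restrict_space1)
qed (auto simp: prob_space_cond prob_space_imp_subprob_space space_restrict_space)

lemma cond_flow:
  assumes "len y \<noteq> \<infinity>" "c \<in> dwell y"
  shows "cond (\<phi> c y) = cond y"
proof (rule measure_eqI)
  fix B assume "B \<in> sets (cond (\<phi> c y))"
  then show "emeasure (cond (\<phi> c y)) B = emeasure (cond y) B"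
    using assms by (simp add: emeasure_cond len_flow emeasure_stay_flow[OF open_U])
qed simp

text \<open>Only arrivals in \<open>B\<close> are counted. What \<open>y\<close> sends there is
  \<open>cond y B\<close>; a point \<open>y\<close> of \<open>B \<inter> U\<close> receives at rate
  \<open>1 / len y\<close> for a total time \<open>len y\<close>, that is, mass 1.\<close>

lemma nn_integral_cond:
  assumes B: "B \<in> sets borel"
  shows "(\<integral>\<^sup>+y. emeasure (cond y) B * indicator U y \<partial>\<mu>) = emeasure \<mu> (B \<inter> U)"
proof -
  note B[measurable]
  define F :: "'a \<Rightarrow> real \<Rightarrow> ennreal" where
    "F y s = indicator B (\<phi> s y) / len y * indicator (dwell y) s" for y s
  have Fm: "(\<lambda>(y, s). F y s) \<in> borel_measurable (borel \<Otimes>\<^sub>M borel)"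
    unfolding F_def case_prod_beta' by measurable
  have "(\<integral>\<^sup>+y. emeasure (cond y) B * indicator U y \<partial>\<mu>) = (\<integral>\<^sup>+y. \<integral>\<^sup>+s. F y s \<partial>lborel \<partial>\<mu>)"
  proof (rule nn_integral_cong_AE)
    show "AE y in \<mu>. emeasure (cond y) B * indicator U y = (\<integral>\<^sup>+s. F y s \<partial>lborel)"
      using AE_len_finite
    proof eventually_elim
      case (elim y)
      have "(\<integral>\<^sup>+s. F y s \<partial>lborel) = (\<integral>\<^sup>+s. 1 / len y * indicator {s \<in> dwell y. \<phi> s y \<in> B} s \<partial>lborel)"
        by (intro nn_integral_cong) (auto simp: F_def split: split_indicator)
      also have "\<dots> = 1 / len y * emeasure lborel {s \<in> dwell y. \<phi> s y \<in> B}"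
        by (rule nn_integral_cmult_indicator) measurable
      also have "\<dots> = emeasure (cond y) B * indicator U y"
      proof (cases "y \<in> U")
        case False
        then have "dwell y = {}" using stay_imp by blast
        then show ?thesis using False by simp
      qed (use elim B in \<open>simp add: emeasure_cond ennreal_divide_times\<close>)
      finally show ?case by simp
    qed
  qed
  also have "\<dots> = (\<integral>\<^sup>+y. \<integral>\<^sup>+s. F (\<phi> (- s) y) s \<partial>lborel \<partial>\<mu>)"
    by (rule mass_transport[OF Fm])
  also have "\<dots> = (\<integral>\<^sup>+y. indicator (B \<inter> U) y \<partial>\<mu>)"
  proof (rule nn_integral_cong_AE)
    show "AE y in \<mu>. (\<integral>\<^sup>+s. F (\<phi> (- s) y) s \<partial>lborel) = indicator (B \<inter> U) y"
      using AE_len_finite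
    proof eventually_elim
      case (elim y)
      have "F (\<phi> (- s) y) s = indicator B y / len y * indicator {s. - s \<in> dwell y} s" for s
      proof (cases "- s \<in> dwell y")
        case True
        then show ?thesis using stay_minus[of "- s" U y] by (simp add: F_def len_flow flow_flow)
      next
        case False
        then show ?thesis using stay_minus[of "- s" U y] by (simp add: F_def)
      qed
      then have "(\<integral>\<^sup>+s. F (\<phi> (- s) y) s \<partial>lborel) = indicator B y / len y * emeasure lborel {s. - s \<in> dwell y}"
        by (simp only: ) (rule nn_integral_cmult_indicator, measurable)
      also have "emeasure lborel {s. - s \<in> dwell y} = len y"
        using emeasure_reflected_dwell[of UNIV y] by (simp add: stay_length_def)
      also have "indicator B y / len y * len y = indicator (B \<inter> U) y"
      proof (cases "y \<in> U")
        case False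
        then have "dwell y = {}" using stay_imp by blast
        then show ?thesis using False by (simp add: stay_length_def)
      next
        case True
        then have "0 < len y" "len y < \<infinity>" using elim len_pos by (auto simp: less_top)
        then show ?thesis using True
          by (auto simp: ennreal_divide_times ennreal_divide_self split: split_indicator)
      qed
      finally show ?case .
    qed
  qed
  also have "\<dots> = emeasure \<mu> (B \<inter> U)"
    by (rule nn_integral_indicator) (simp add: sets_mu)
  finally show ?thesis .
qed

end

lemma ennreal_normalized_half:
  assumes "l > 0" "r \<ge> 0"
  shows "1 / (1 / 2 * ennreal l) * (1 / 2 * ennreal r) = ennreal (r / l)"
proof -
  have half: "(1 / 2 :: ennreal) = ennreal (1 / 2)"
    using divide_ennreal[of 1 2] by simp
  have "1 / (1 / 2 * ennreal l) = ennreal 1 / ennreal (1 / 2 * l)"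
    unfolding half using assms(1) by (subst ennreal_mult) auto
  also have "\<dots> = ennreal (2 / l)" using assms(1) by (subst divide_ennreal) auto
  finally have "1 / (1 / 2 * ennreal l) * (1 / 2 * ennreal r) = ennreal (2 / l) * ennreal (1 / 2 * r)"
    unfolding half using assms(2) by (simp only: ennreal_mult)
  also have "\<dots> = ennreal (2 / l * (1 / 2 * r))" using assms by (intro ennreal_mult[symmetric]) auto
  finally show ?thesis by simp
qed

section \<open>The kernel on the transversal and its disintegration identity\<close>

context invariant_chart
begin

text \<open>The kernel must be indexed by the transversal, whereas \<open>cond\<close> is indexed by
  points. A constant coordinate gives a continuous, hence measurable, choice of a point on each
  plaque.\<close>

definition sec :: "'a \<Rightarrow> 'a" where
  "sec z = h (z, SOME i. i \<in> I)"

lemma some_in_I: "(SOME i. i \<in> I) \<in> I"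
  using I_ne by (simp add: some_in_eq)

lemma sec: "z \<in> T \<Longrightarrow> sec z \<in> U" "z \<in> T \<Longrightarrow> base (sec z) = z"
  using h_in[of "(z, SOME i. i \<in> I)"] gh[of "(z, SOME i. i \<in> I)"] some_in_I
  by (auto simp: sec_def)

lemma sec_measurable: "sec \<in> restrict_space borel T \<rightarrow>\<^sub>M restrict_space borel U"
proof (rule measurable_restrict_space2)
  have "continuous_on T (\<lambda>z. h (z, SOME i. i \<in> I))"
    by (intro continuous_on_compose2[OF h_cont] continuous_intros) (auto simp: some_in_I)
  then show "sec \<in> borel_measurable (restrict_space borel T)"
    unfolding sec_def[abs_def] by (rule borel_measurable_continuous_on_restrict)
qed (auto simp: space_restrict_space sec)

text \<open>Lets \<open>cond\<close> be evaluated at \<open>sec z\<close> instead of at an arbitrary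
  point of the plaque. Finiteness matters: on infinite plaques \<open>cond\<close> is the Dirac
  measure at the point itself.\<close>

lemma same_base:
  assumes "x \<in> U" "y \<in> U" "base x = base y"
  shows "len x = len y" "len y \<noteq> \<infinity> \<Longrightarrow> cond x = cond y"
proof -
  have "x \<in> plaque h I (base y)" using in_plaque_iff[OF base_in[OF assms(2)]] assms by blast
  then obtain c where "c \<in> dwell y" "x = \<phi> c y" using plaque_eq_dwell[OF assms(2)] by blast
  then show "len x = len y" "len y \<noteq> \<infinity> \<Longrightarrow> cond x = cond y" by (auto simp: len_flow cond_flow)
qed

lemma emeasure_cond_plaque:
  assumes y: "y \<in> U"
  shows "emeasure (cond y) (plaque h I (base y)) = 1"
proof (cases "len y = \<infinity>")
  case True
  then show ?thesis
    using in_plaque_iff[OF base_in[OF y], of y] y plaque_borel[OF base_in[OF y]] by (simp add: cond_def)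
next
  case False
  have "{s \<in> dwell y. \<phi> s y \<in> plaque h I (base y)} = dwell y" using plaque_eq_dwell[OF y] by auto
  then have "emeasure (cond y) (plaque h I (base y)) = len y / len y"
    using emeasure_cond[OF False plaque_borel[OF base_in[OF y]]] by (simp add: stay_length_def)
  then show ?thesis using False len_pos[OF y] by (simp add: ennreal_divide_self less_top)
qed

text \<open>Both sides are the uniform distribution on \<open>dwell x\<close>, transported by the flow; the factor
  \<open>1 / 2\<close> in the leaf measure cancels.\<close>

lemma cond_eq_normalized_leaf_measure:
  assumes x: "x \<in> U" and fin: "len x \<noteq> \<infinity>"
  shows "restrict_space (cond x) (plaque h I (base x)) =
    normalized_restriction (leaf_measure (orbit \<phi> x)) (plaque h I (base x))"
proof -
  define P where "P = plaque h I (base x)"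
  define m where "m = leaf_measure (orbit \<phi> x)"
  have Pd: "P = (\<lambda>t. \<phi> t x) ` dwell x" unfolding P_def by (rule plaque_eq_dwell[OF x])
  have P: "P \<in> sets borel" "P \<subseteq> orbit \<phi> x"
    using plaque_borel[OF base_in[OF x]] Pd by (auto simp: P_def)
  have sets_m: "sets m = sets (restrict_space borel (orbit \<phi> x))"
    unfolding m_def by (rule sets_leaf_measure[OF not_fixed[OF x]])
  have space_m: "space m = orbit \<phi> x"
    using sets_eq_imp_space_eq[OF sets_m] by (simp add: space_restrict_space)
  have Pm: "P \<in> sets m" using P orbit_borel[of x] by (simp add: sets_m sets_restrict_space_iff)
  have em: "emeasure m A = 1 / 2 * emeasure lborel {s \<in> dwell x. \<phi> s x \<in> A}" if "A \<in> sets borel" "A \<subseteq> P" for A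
    unfolding m_def using that Pd
    by (intro emeasure_leaf_measure[OF not_fixed[OF x] dwell_borel inj_on_dwell[OF x]]) auto
  have "{s \<in> dwell x. \<phi> s x \<in> P} = dwell x" using Pd by auto
  then have emP: "emeasure m P = 1 / 2 * len x" using em[OF P(1)] by (simp add: stay_length_def)
  have "restrict_space (cond x) P = normalized_restriction m P"
  proof (rule measure_eqI)
    have "sets (restrict_space m P) = sets (restrict_space borel P)"
    proof -
      have "P \<inter> (orbit \<phi> x \<inter> A) = P \<inter> A" for A using P(2) by blast
      then show ?thesis by (simp add: sets_restrict_space sets_m image_image)
    qed
    then show sets_eq: "sets (restrict_space (cond x) P) = sets (normalized_restriction m P)"
      by (simp add: normalized_restriction_def sets_restrict_space)
    fix A assume "A \<in> sets (restrict_space (cond x) P)"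
    then have A: "A \<in> sets borel" "A \<subseteq> P" using P(1) by (auto simp: sets_restrict_space_iff)
    define X where "X = emeasure lborel {s \<in> dwell x. \<phi> s x \<in> A}"
    have "emeasure (restrict_space (cond x) P) A = X / len x"
      using A P(1) by (simp add: emeasure_restrict_space emeasure_cond[OF fin] X_def)
    moreover have "emeasure (normalized_restriction m P) A = 1 / (1 / 2 * len x) * (1 / 2 * X)"
      using A Pm em[OF A] by (simp add: normalized_restriction_def emeasure_restrict_space emP X_def)
    moreover have "X \<le> len x"
      unfolding X_def stay_length_def by (rule emeasure_mono) auto
    moreover obtain l where l: "len x = ennreal l" "l > 0"
      using fin len_pos[OF x] by (cases "len x") auto
    moreover obtain r where "X = ennreal r" "r \<ge> 0"
      using \<open>X \<le> len x\<close> l by (cases X) (auto simp: top_unique)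
    ultimately show "emeasure (restrict_space (cond x) P) A = emeasure (normalized_restriction m P) A"
      by (simp only: ennreal_normalized_half) (simp add: divide_ennreal)
  qed
  then show ?thesis by (simp add: P_def m_def)
qed

lemma base_measurable: "(\<lambda>y. base y) \<in> restrict_space borel U \<rightarrow>\<^sub>M restrict_space borel T"
proof (rule measurable_restrict_space2)
  show "(\<lambda>y. base y) \<in> borel_measurable (restrict_space borel U)"
    by (rule borel_measurable_continuous_on_restrict) (intro continuous_intros g_cont)
qed (auto simp: space_restrict_space base_in)

definition "plaque_law = plaque_space_measure \<mu> U T g"

lemma sets_normalized_restriction [measurable_cong]:
  "sets (normalized_restriction \<mu> U) = sets (restrict_space borel U)"
  by (simp add: normalized_restriction_def sets_restrict_space sets_mu)

lemma sets_plaque_law [simp, measurable_cong]: "sets plaque_law = sets (restrict_space borel T)"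
  by (simp add: plaque_law_def plaque_space_measure_def)

lemma space_plaque_law [simp]: "space plaque_law = T"
  using sets_eq_imp_space_eq[OF sets_plaque_law] by (simp add: space_restrict_space)

lemma nn_integral_plaque_law:
  assumes f: "f \<in> borel_measurable (restrict_space borel T)"
  shows "(\<integral>\<^sup>+z. f z \<partial>plaque_law) = 1 / emeasure \<mu> U * (\<integral>\<^sup>+y. f (base y) * indicator U y \<partial>\<mu>)"
proof -
  have b: "(\<lambda>y. base y) \<in> normalized_restriction \<mu> U \<rightarrow>\<^sub>M restrict_space borel T"
    using base_measurable by (simp add: measurable_cong_sets[OF sets_normalized_restriction refl])
  have fb: "(\<lambda>y. f (base y)) \<in> borel_measurable (restrict_space \<mu> U)"
    using measurable_compose[OF base_measurable f]
    by (simp add: measurable_cong_sets[OF sets_restrict_space_cong[OF sets_mu] refl])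
  have "(\<integral>\<^sup>+z. f z \<partial>plaque_law) = (\<integral>\<^sup>+y. f (base y) \<partial>normalized_restriction \<mu> U)"
    unfolding plaque_law_def plaque_space_measure_def by (rule nn_integral_distr[OF b]) (simp add: f)
  also have "\<dots> = 1 / emeasure \<mu> U * (\<integral>\<^sup>+y. f (base y) \<partial>restrict_space \<mu> U)"
    unfolding normalized_restriction_def by (rule nn_integral_scale_measure[OF fb])
  also have "(\<integral>\<^sup>+y. f (base y) \<partial>restrict_space \<mu> U) = (\<integral>\<^sup>+y. f (base y) * indicator U y \<partial>\<mu>)"
    by (rule nn_integral_restrict_space) (simp add: sets_mu)
  finally show ?thesis .
qed

lemma kernel_measurable: "(\<lambda>z. cond (sec z)) \<in> restrict_space borel T \<rightarrow>\<^sub>M prob_algebra borel"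
  by (rule measurable_compose[OF sec_measurable cond_measurable])

lemma kernel_measurable_subprob: "(\<lambda>z. cond (sec z)) \<in> plaque_law \<rightarrow>\<^sub>M subprob_algebra borel"
  using measurable_prob_algebraD[OF kernel_measurable]
  by (simp add: measurable_cong_sets[OF sets_plaque_law refl])

lemma AE_plaque_law_len: "AE z in plaque_law. len (sec z) \<noteq> \<infinity>"
proof -
  have m: "{z \<in> space (restrict_space borel T). len (sec z) = \<infinity>} \<in> sets (restrict_space borel T)"
  proof -
    have "(\<lambda>z. len (sec z)) \<in> borel_measurable (restrict_space borel T)"
      by (rule measurable_compose[OF sec_measurable])
        (rule measurable_restrict_space1, rule len_measurable)
    then show ?thesis by measurable
  qed
  then have N: "{z \<in> T. len (sec z) = \<infinity>} \<in> sets (restrict_space borel T)"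
    by (simp add: space_restrict_space)
  have "emeasure plaque_law {z \<in> T. len (sec z) = \<infinity>} =
      (\<integral>\<^sup>+z. indicator {z \<in> T. len (sec z) = \<infinity>} z \<partial>plaque_law)"
    using N by simp
  also have "\<dots> = 1 / emeasure \<mu> U *
      (\<integral>\<^sup>+y. indicator {z \<in> T. len (sec z) = \<infinity>} (base y) * indicator U y \<partial>\<mu>)"
    by (rule nn_integral_plaque_law[OF borel_measurable_indicator[OF N]])
  also have "(\<integral>\<^sup>+y. indicator {z \<in> T. len (sec z) = \<infinity>} (base y) * indicator U y \<partial>\<mu>) = (\<integral>\<^sup>+y. 0 \<partial>\<mu>)"
  proof (rule nn_integral_cong_AE)
    show "AE y in \<mu>. indicator {z \<in> T. len (sec z) = \<infinity>} (base y) * indicator U y = (0 :: ennreal)"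
      using AE_len_finite
    proof eventually_elim
      case (elim y)
      show ?case
      proof (cases "y \<in> U")
        case True
        then have "len (sec (base y)) = len y" using sec base_in by (intro same_base) auto
        then show ?thesis using elim True by simp
      qed simp
    qed
  qed
  finally have "emeasure plaque_law {z \<in> T. len (sec z) = \<infinity>} = 0" by simp
  then show ?thesis using N by (intro AE_I[of _ _ "{z \<in> T. len (sec z) = \<infinity>}"]) auto
qed

lemma AE_kernel_leaf_measure:
  "AE z in plaque_law. \<forall>x\<in>plaque h I z. restrict_space (cond (sec z)) (plaque h I z) =
     normalized_restriction (leaf_measure (orbit \<phi> x)) (plaque h I z)"
  using AE_plaque_law_len AE_space
proof eventually_elim
  case (elim z)
  then have z: "z \<in> T" by simp
  show ?case
  proof
    fix x assume "x \<in> plaque h I z"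
    then have x: "x \<in> U" "base x = z" using in_plaque_iff[OF z] by auto
    then have "len x = len (sec z)" "cond x = cond (sec z)"
      using same_base[OF x(1) sec(1)[OF z]] sec(2)[OF z] elim by auto
    then show "restrict_space (cond (sec z)) (plaque h I z) =
        normalized_restriction (leaf_measure (orbit \<phi> x)) (plaque h I z)"
      using cond_eq_normalized_leaf_measure[OF x(1)] elim x(2) by simp
  qed
qed

context
  assumes pos: "emeasure \<mu> U > 0"
begin

text \<open>The disintegration on the level of sets. Since \<open>cond (sec (base y))\<close> equals
  \<open>cond y\<close> for almost every \<open>y\<close> in \<open>U\<close>, it is the transport
  identity \<open>nn_integral_cond\<close> divided by the mass of \<open>U\<close>.\<close>

lemma bind_plaque_law: "plaque_law \<bind> (\<lambda>z. cond (sec z)) = uniform_measure \<mu> U"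
proof -
  have "U \<noteq> {}" using pos by auto
  then have ne: "space plaque_law \<noteq> {}" using base_in by auto
  show ?thesis
  proof (rule measure_eqI)
    show sets: "sets (plaque_law \<bind> (\<lambda>z. cond (sec z))) = sets (uniform_measure \<mu> U)"
      using sets_bind[OF _ ne, of "\<lambda>z. cond (sec z)" borel] by (simp add: sets_mu)
    fix B assume "B \<in> sets (plaque_law \<bind> (\<lambda>z. cond (sec z)))"
    then have B: "B \<in> sets borel" using sets by (simp add: sets_mu)
    have m: "(\<lambda>z. emeasure (cond (sec z)) B) \<in> borel_measurable (restrict_space borel T)"
      using measurable_compose[OF measurable_prob_algebraD[OF kernel_measurable]
          measurable_emeasure_subprob_algebra[OF B]] .
    have "emeasure (plaque_law \<bind> (\<lambda>z. cond (sec z))) B = (\<integral>\<^sup>+z. emeasure (cond (sec z)) B \<partial>plaque_law)"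
      by (rule emeasure_bind[OF ne kernel_measurable_subprob B])
    also have "\<dots> = 1 / emeasure \<mu> U * (\<integral>\<^sup>+y. emeasure (cond (sec (base y))) B * indicator U y \<partial>\<mu>)"
      by (rule nn_integral_plaque_law[OF m])
    also have "(\<integral>\<^sup>+y. emeasure (cond (sec (base y))) B * indicator U y \<partial>\<mu>) =
        (\<integral>\<^sup>+y. emeasure (cond y) B * indicator U y \<partial>\<mu>)"
    proof (rule nn_integral_cong_AE)
      show "AE y in \<mu>. emeasure (cond (sec (base y))) B * indicator U y =
          emeasure (cond y) B * indicator U y"
        using AE_len_finite
      proof eventually_elim
        case (elim y)
        show ?case
        proof (cases "y \<in> U")
          case True
          then have "cond (sec (base y)) = cond y"
            using same_base(2)[of "sec (base y)" y] sec base_in elim by auto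
          then show ?thesis by simp
        qed simp
      qed
    qed
    also have "\<dots> = emeasure \<mu> (B \<inter> U)" by (rule nn_integral_cond[OF B])
    also have "1 / emeasure \<mu> U * emeasure \<mu> (B \<inter> U) = emeasure (uniform_measure \<mu> U) B"
      using B by (simp add: sets_mu Int_commute ennreal_divide_times)
    finally show "emeasure (plaque_law \<bind> (\<lambda>z. cond (sec z))) B = emeasure (uniform_measure \<mu> U) B" .
  qed
qed

lemma emeasure_plaque_law: "emeasure plaque_law T = 1"
proof -
  have T: "T \<in> sets (restrict_space borel T)" using sets.top[of "restrict_space borel T"]
    by (simp add: space_restrict_space)
  have "emeasure plaque_law T = (\<integral>\<^sup>+z. indicator T z \<partial>plaque_law)" using T by simp
  also have "\<dots> = 1 / emeasure \<mu> U * (\<integral>\<^sup>+y. indicator T (base y) * indicator U y \<partial>\<mu>)"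
    by (rule nn_integral_plaque_law[OF borel_measurable_indicator[OF T]])
  also have "(\<integral>\<^sup>+y. indicator T (base y) * indicator U y \<partial>\<mu>) = (\<integral>\<^sup>+y. indicator U y \<partial>\<mu>)"
    by (intro nn_integral_cong) (auto split: split_indicator simp: base_in)
  also have "\<dots> = emeasure \<mu> U" by (rule nn_integral_indicator) (simp add: sets_mu)
  also have "1 / emeasure \<mu> U * emeasure \<mu> U = 1"
    using pos by (simp add: ennreal_divide_times ennreal_divide_self less_top[symmetric])
  finally show ?thesis .
qed

lemma disintegration: "disintegration_in_chart \<mu> U T I h g (\<lambda>z. cond (sec z))"
  unfolding disintegration_in_chart_def
proof (intro conjI allI impI, fold plaque_law_def)
  show "(\<lambda>z. cond (sec z)) \<in> restrict_space borel T \<rightarrow>\<^sub>M prob_algebra borel"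
    by (rule kernel_measurable)
  have one: "emeasure (cond (sec z)) (plaque h I z) = 1" if "z \<in> T" for z
    using emeasure_cond_plaque[OF sec(1)[OF that]] sec(2)[OF that] by simp
  then show "AE z in plaque_law. emeasure (cond (sec z)) (plaque h I z) = 1"
    by (intro AE_I2) simp
  fix b :: "'a \<Rightarrow> real" assume b: "continuous_on U b \<and> bounded (b ` U)"
  \<comment> \<open>Extending \<open>b\<close> by zero gives a bounded Borel function on the whole
    space, to which \<open>integral_bind\<close> applies; on plaques it agrees with
    \<open>b\<close>.\<close>
  define c where "c y = indicator U y *\<^sub>R b y" for y
  have cm: "c \<in> borel_measurable borel"
    unfolding c_def[abs_def] using b by (intro borel_measurable_continuous_on_indicator U_borel) auto
  obtain C where C: "\<And>y. y \<in> U \<Longrightarrow> \<bar>b y\<bar> \<le> C" using b by (auto simp: bounded_iff)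
  have cb: "\<bar>c y\<bar> \<le> \<bar>C\<bar>" for y using C[of y] by (auto simp: c_def split: split_indicator)
  have mU: "measure \<mu> U > 0" using pos by (simp add: emeasure_eq_measure)
  have "(LINT y:U|\<mu>. b y) / measure \<mu> U = (\<integral>y. c y \<partial>\<mu>) / measure \<mu> U"
    by (simp add: set_lebesgue_integral_def c_def)
  also have "\<dots> = (\<integral>y. (indicator U y / measure \<mu> U) *\<^sub>R c y \<partial>\<mu>)"
  proof -
    have "(\<lambda>y. (indicator U y / measure \<mu> U) *\<^sub>R c y) = (\<lambda>y. c y / measure \<mu> U)"
      by (auto simp: c_def fun_eq_iff split: split_indicator)
    then show ?thesis by simp
  qed
  also have "\<dots> = (\<integral>y. c y \<partial>density \<mu> (\<lambda>y. ennreal (indicator U y / measure \<mu> U)))"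
    using cm mU by (intro integral_density[symmetric]) (auto simp: sets_mu measurable_cong_sets[OF sets_mu refl])
  also have "density \<mu> (\<lambda>y. ennreal (indicator U y / measure \<mu> U)) = uniform_measure \<mu> U"
    unfolding uniform_measure_def
  proof (rule arg_cong[of _ _ "density \<mu>"], rule ext)
    fix y
    show "ennreal (indicator U y / measure \<mu> U) = indicator U y / emeasure \<mu> U"
      using mU by (auto simp: emeasure_eq_measure divide_ennreal[symmetric] split: split_indicator)
  qed
  also have "(\<integral>y. c y \<partial>uniform_measure \<mu> U) = (\<integral>y. c y \<partial>(plaque_law \<bind> (\<lambda>z. cond (sec z))))"
    by (simp add: bind_plaque_law)
  also have "\<dots> = (\<integral>z. \<integral>y. c y \<partial>cond (sec z) \<partial>plaque_law)"
  proof (rule integral_bind[OF cm cb kernel_measurable_subprob])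
    show "finite_measure plaque_law"
      by (rule finite_measureI) (simp add: emeasure_plaque_law)
    show "AE z in plaque_law. emeasure (cond (sec z)) (space (cond (sec z))) \<le> ennreal 1"
      using prob_space.emeasure_space_1[OF prob_space_cond[OF sec(1)]] by (intro AE_I2) simp
  qed
  also have "\<dots> = (\<integral>z. (LINT y:plaque h I z|cond (sec z). b y) \<partial>plaque_law)"
  proof (rule Bochner_Integration.integral_cong[OF refl])
    fix z assume "z \<in> space plaque_law"
    then have z: "z \<in> T" by simp
    interpret K: prob_space "cond (sec z)" by (rule prob_space_cond[OF sec(1)[OF z]])
    have AE: "AE y in cond (sec z). y \<in> plaque h I z"
      using one[OF z] by (intro K.AE_prob_1) (simp add: measure_def)
    have pb: "indicator (plaque h I z) y *\<^sub>R b y = indicator (plaque h I z) y *\<^sub>R c y" for y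
      using in_plaque_iff[OF z, of y] by (auto simp: c_def split: split_indicator)
    have "(\<lambda>y. indicator (plaque h I z) y *\<^sub>R c y) \<in> borel_measurable borel"
      using cm plaque_borel[OF z] by (intro borel_measurable_scaleR borel_measurable_indicator) auto
    then have "(\<integral>y. c y \<partial>cond (sec z)) = (\<integral>y. indicator (plaque h I z) y *\<^sub>R c y \<partial>cond (sec z))"
      using cm AE by (intro integral_cong_AE) (auto simp: measurable_cong_sets[OF sets_cond refl])
    then show "(\<integral>y. c y \<partial>cond (sec z)) = (LINT y:plaque h I z|cond (sec z). b y)"
      unfolding set_lebesgue_integral_def pb .
  qed
  finally show "(LINT y:U|\<mu>. b y) / measure \<mu> U =
      (LINT z|plaque_law. (LINT y:plaque h I z|cond (sec z). b y))" .
qed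

end

end

section \<open>The two alternatives\<close>

lemma (in invariant_flow) disintegrates_along_orbits_leaf_measure:
  "disintegrates_along_orbits \<phi> \<mu> leaf_measure"
  unfolding disintegrates_along_orbits_def
proof (intro allI impI, elim conjE)
  fix U T I h g
  assume chart: "foliated_chart \<phi> U T I h g" and pos: "emeasure \<mu> U > 0"
  interpret invariant_chart \<phi> U T I h g \<mu> by unfold_locales (rule chart)
  show "\<exists>\<kappa>. disintegration_in_chart \<mu> U T I h g \<kappa> \<and>
      (AE z in plaque_space_measure \<mu> U T g. \<forall>x\<in>plaque h I z.
         restrict_space (\<kappa> z) (plaque h I z) =
         normalized_restriction (leaf_measure (orbit \<phi> x)) (plaque h I z))"
    using disintegration[OF pos] AE_kernel_leaf_measure unfolding plaque_law_def by blast
qed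

theorem theorem1:
  fixes \<phi> :: "real \<Rightarrow> 'a::{metric_space, second_countable_topology} \<Rightarrow> 'a"
    and \<mu> :: "'a measure"
  assumes "continuous_flow \<phi>"
    and "prob_space \<mu>" and "sets \<mu> = sets borel"
    and "ergodic (\<phi> 1) \<mu>"
  shows
    "(\<exists>A\<in>sets \<mu>. emeasure \<mu> A = 1 \<and>
        (AE x in \<mu>. discrete_in_leaf \<phi> x (orbit \<phi> x \<inter> A)) \<and>
        (\<exists>k::nat. k \<ge> 1 \<and>
          (AE x in \<mu>. \<exists>C. C \<subseteq> range (time_one_orbit \<phi>) \<and> card C = k \<and>
                          orbit \<phi> x \<inter> A = \<Union>C)))
     \<or>
     (\<exists>m :: 'a set \<Rightarrow> 'a measure.
        (AE x in \<mu>.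
           sets (m (orbit \<phi> x)) = sets (restrict_space borel (orbit \<phi> x)) \<and>
           (\<forall>t\<ge>0. inj_on (\<lambda>\<tau>. \<phi> \<tau> x) {0..t} \<longrightarrow>
              emeasure (m (orbit \<phi> x)) ((\<lambda>\<tau>. \<phi> \<tau> x) ` {0..t}) = ennreal (t / 2)) \<and>
           invariant_measure (\<phi> 1) (m (orbit \<phi> x))) \<and>
        disintegrates_along_orbits \<phi> \<mu> m \<and>
        (\<forall>t. distr \<mu> \<mu> (\<phi> t) = \<mu>))"
proof -
  interpret prob_space \<mu> by fact
  interpret ergodic_flow \<phi> \<mu>
    by unfold_locales (use assms in auto)
  have full: "emeasure \<mu> A = 1" if "A \<in> sets borel" "AE x in \<mu>. x \<in> A" for A
    using that by (intro emeasure_eq_1_AE) (auto simp: sets_mu)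
  consider (fixed) x0 where "\<forall>t. \<phi> t x0 = x0" "AE x in \<mu>. x = x0"
    | (generic) "symmetries \<noteq> UNIV"
    | (invariant) "AE x in \<mu>. \<not> (\<forall>t. \<phi> t x = x)" "symmetries = UNIV"
    using fixed_cases by blast
  then show ?thesis
  proof cases
    case fixed
    have "emeasure \<mu> {x0} = 1" using fixed(2) by (intro full) auto
    then show ?thesis
      using transversal_of_fixed_point[OF fixed]
      by (intro disjI1 bexI[of _ "{x0}"] conjI exI[of _ 1]) (auto simp: sets_mu)
  next
    case generic
    have "emeasure \<mu> {y. generic \<mu> y} = 1"
      using AE_generic by (intro full generic_set) simp
    then show ?thesis
      using transversal_generic[OF generic] generic_set sets_mu by blast
  next
    case invariant
    then have inv: "distr \<mu> \<mu> (\<phi> t) = \<mu>" for t by (auto simp: symmetries_def)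
    interpret invariant_flow \<phi> \<mu> by unfold_locales (rule sets_mu inv)+
    have "AE x in \<mu>.
        sets (leaf_measure (orbit \<phi> x)) = sets (restrict_space borel (orbit \<phi> x)) \<and>
        (\<forall>t\<ge>0. inj_on (\<lambda>\<tau>. \<phi> \<tau> x) {0..t} \<longrightarrow>
           emeasure (leaf_measure (orbit \<phi> x)) ((\<lambda>\<tau>. \<phi> \<tau> x) ` {0..t}) = ennreal (t / 2)) \<and>
        invariant_measure (\<phi> 1) (leaf_measure (orbit \<phi> x))"
      using invariant(1)
      by eventually_elim
        (use sets_leaf_measure emeasure_leaf_measure_segment invariant_leaf_measure in blast)
    then show ?thesis
      using disintegrates_along_orbits_leaf_measure inv by blast
  qed
qed

end
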